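(* Let $K$ be a finite simplicial complex of dimension greater than $p$ whose boundary matrix $[\partial_{p+1}]$ is totally unimodular. Then, given a $p$-chain of $K$ that takes values in $\{-1,0,1\}$, a homologous $p$-chain with values in $\{-1,0,1\}$ having the smallest number of nonzero entries (among homologous $p$-chains with values in $\{-1,0,1\}$) can be found in polynomial time.
   Context: Each simplex of $K$ is given an arbitrary fixed orientation, and chains have $\mathbb{Z}$ coefficients. Let $m$ and $n$ be the numbers of $p$- and $(p+1)$-simplices of $K$. $[\partial_{p+1}]$ is the $m\times n$ matrix of the simplicial boundary operator $\partial_{p+1}\colon C_{p+1}(K)\to C_p(K)$ in the bases of oriented simplices. An integer matrix is totally unimodular if every square submatrix has determinant $0$, $1$ or $-1$. A $p$-chain is identified with its coefficient vector in $\mathbb{Z}^m$. Two $p$-chains $\mathbf{c},\mathbf{c}'$ are homologous if $\mathbf{c}=\mathbf{c}'+[\partial_{p+1}]\mathbf{y}$ for some $\mathbf{y}\in\mathbb{Z}^n$. Polynomial time means a number of arithmetic operations polynomial in the number of simplices. *)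

theory Defs
  imports
    "Jordan_Normal_Form.Matrix"
    "Jordan_Normal_Form.Determinant"
    "Jordan_Normal_Form.DL_Submatrix"
    "HOL-Combinatorics.Permutations"
    "HOL-Combinatorics.List_Permutation"
    "HOL-Computational_Algebra.Polynomial"
begin

section \<open>Simplicial complexes and boundary matrices\<close>

text \<open>Complexes are abstract. A simplex is the nonempty finite set of its vertices;
  the empty set is not a simplex.\<close>

definition finite_simplicial_complex :: "'v set set \<Rightarrow> bool" where
  "finite_simplicial_complex K \<longleftrightarrow>
     finite K \<and> (\<forall>\<sigma>\<in>K. finite \<sigma> \<and> \<sigma> \<noteq> {}) \<and>
     (\<forall>\<sigma>\<in>K. \<forall>\<tau>. \<tau> \<subseteq> \<sigma> \<and> \<tau> \<noteq> {} \<longrightarrow> \<tau> \<in> K)"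

definition simplices :: "'v set set \<Rightarrow> nat \<Rightarrow> 'v set set" where
  "simplices K p = {\<sigma> \<in> K. card \<sigma> = p + 1}"

text \<open>The empty complex has dimension \<open>-1\<close>.\<close>

definition complex_dim :: "'v set set \<Rightarrow> int" where
  "complex_dim K = Max (insert (-1) ((\<lambda>\<sigma>. int (card \<sigma>) - 1) ` K))"

text \<open>An oriented simplex is represented by an ordering of its vertices. A list of oriented
  simplices that meets every \<open>p\<close>-simplex exactly once fixes an orientation of each
  \<open>p\<close>-simplex together with an enumeration of the resulting basis of \<open>C\<^sub>p(K)\<close>.\<close>

definition oriented_basis :: "'v set set \<Rightarrow> nat \<Rightarrow> 'v list list \<Rightarrow> bool" where
  "oriented_basis K p P \<longleftrightarrow>
     (\<forall>xs\<in>set P. distinct xs) \<and> distinct (map set P) \<and> set (map set P) = simplices K p"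

text \<open>The coefficient of the basis element \<open>[ys]\<close> in the oriented simplex \<open>[xs]\<close>: it is
  nonzero only if both have the same vertices, and is then the sign of the permutation that
  relates the two orderings (unique, since vertices are not repeated).\<close>

definition orientation_coeff :: "'v list \<Rightarrow> 'v list \<Rightarrow> int" where
  "orientation_coeff xs ys =
     (if set xs = set ys
      then sign (THE \<pi>. \<pi> permutes {..<length xs} \<and> permute_list \<pi> xs = ys)
      else 0)"

text \<open>The matrix of the boundary operator that maps \<open>[v\<^sub>0, \<dots>, v\<^sub>q]\<close> to the alternating sum
  of the \<open>[v\<^sub>0, \<dots>, v\<^sub>k\<^sub>-\<^sub>1, v\<^sub>k\<^sub>+\<^sub>1, \<dots>, v\<^sub>q]\<close>, from the basis \<open>Q\<close> to the basis \<open>P\<close>.\<close>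

definition boundary_matrix :: "'v list list \<Rightarrow> 'v list list \<Rightarrow> int mat" where
  "boundary_matrix P Q = mat (length P) (length Q) (\<lambda>(i, j).
     \<Sum>k<length (Q ! j).
       (-1) ^ k * orientation_coeff (take k (Q ! j) @ drop (Suc k) (Q ! j)) (P ! i))"

definition totally_unimodular :: "int mat \<Rightarrow> bool" where
  "totally_unimodular A \<longleftrightarrow>
     (\<forall>I J. I \<subseteq> {..<dim_row A} \<and> J \<subseteq> {..<dim_col A} \<and> card I = card J
        \<longrightarrow> det (submatrix A I J) \<in> {-1, 0, 1})"


section \<open>Optimal homologous chains\<close>

text \<open>Chains are given by their coefficient vectors, and \<open>D\<close> is the boundary matrix.\<close>

definition homologous :: "int mat \<Rightarrow> int vec \<Rightarrow> int vec \<Rightarrow> bool" where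
  "homologous D c c' \<longleftrightarrow> (\<exists>y \<in> carrier_vec (dim_col D). c = c' + D *\<^sub>v y)"

definition signed_unit_chain :: "nat \<Rightarrow> int vec \<Rightarrow> bool" where
  "signed_unit_chain m c \<longleftrightarrow> c \<in> carrier_vec m \<and> (\<forall>i<m. c $ i \<in> {-1, 0, 1})"

definition num_nonzero :: "int vec \<Rightarrow> nat" where
  "num_nonzero c = card {i. i < dim_vec c \<and> c $ i \<noteq> 0}"

definition optimal_homologous_chain :: "int mat \<Rightarrow> int vec \<Rightarrow> int vec \<Rightarrow> bool" where
  "optimal_homologous_chain D c z \<longleftrightarrow>
     signed_unit_chain (dim_row D) z \<and> homologous D z c \<and>
     (\<forall>z'. signed_unit_chain (dim_row D) z' \<and> homologous D z' c
        \<longrightarrow> num_nonzero z \<le> num_nonzero z')"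


section \<open>Algorithms and the number of their operations\<close>

text \<open>Algorithms are while-programs over integer variables and integer arrays (with
  computed indices), both named by natural numbers. Integers are unbounded and every
  elementary step has unit cost, so running time counts operations. Not only arithmetic
  operations are charged but also constants, memory accesses, comparisons, Boolean
  connectives, assignments and branchings; otherwise unbounded work could be hidden in
  steps that are free of charge.

  The arithmetic operations are \<open>+\<close>, \<open>-\<close> and \<open>*\<close>. Exact rational arithmetic is available
  at constant-factor cost through pairs of numerator and denominator. Rounding and integer
  division are deliberately absent: together with multiplication at unit cost they would
  make all of PSPACE computable in polynomially many steps.\<close>

datatype aexp =
    Const int
  | Var nat
  | Elem nat aexp
  | Plus aexp aexp
  | Minus aexp aexp
  | Times aexp aexp

datatype bexp =
    Less aexp aexp
  | Not bexp
  | And bexp bexp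

datatype prog =
    Skip
  | Assign nat aexp
  | Store nat aexp aexp
  | Seq prog prog
  | If bexp prog prog
  | While bexp prog

datatype state = State (vars: "nat \<Rightarrow> int") (arrays: "nat \<Rightarrow> int \<Rightarrow> int")

fun aval :: "aexp \<Rightarrow> state \<Rightarrow> int" where
  "aval (Const k) s = k"
| "aval (Var x) s = vars s x"
| "aval (Elem a e) s = arrays s a (aval e s)"
| "aval (Plus e f) s = aval e s + aval f s"
| "aval (Minus e f) s = aval e s - aval f s"
| "aval (Times e f) s = aval e s * aval f s"

fun bval :: "bexp \<Rightarrow> state \<Rightarrow> bool" where
  "bval (Less e f) s \<longleftrightarrow> aval e s < aval f s"
| "bval (Not b) s \<longleftrightarrow> \<not> bval b s"
| "bval (And b c) s \<longleftrightarrow> bval b s \<and> bval c s"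

fun acost :: "aexp \<Rightarrow> nat" where
  "acost (Const k) = 1"
| "acost (Var x) = 1"
| "acost (Elem a e) = 1 + acost e"
| "acost (Plus e f) = 1 + acost e + acost f"
| "acost (Minus e f) = 1 + acost e + acost f"
| "acost (Times e f) = 1 + acost e + acost f"

fun bcost :: "bexp \<Rightarrow> nat" where
  "bcost (Less e f) = 1 + acost e + acost f"
| "bcost (Not b) = 1 + bcost b"
| "bcost (And b c) = 1 + bcost b + bcost c"

definition set_var :: "nat \<Rightarrow> int \<Rightarrow> state \<Rightarrow> state" where
  "set_var x v s = State ((vars s)(x := v)) (arrays s)"

definition set_elem :: "nat \<Rightarrow> int \<Rightarrow> int \<Rightarrow> state \<Rightarrow> state" where
  "set_elem a i v s = State (vars s) ((arrays s)(a := (arrays s a)(i := v)))"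

text \<open>\<open>runs c s t s'\<close>: started in \<open>s\<close>, program \<open>c\<close> terminates in \<open>s'\<close> after \<open>t\<close> steps.\<close>

inductive runs :: "prog \<Rightarrow> state \<Rightarrow> nat \<Rightarrow> state \<Rightarrow> bool" where
  Skip: "runs Skip s 1 s"
| Assign: "runs (Assign x e) s (1 + acost e) (set_var x (aval e s) s)"
| Store: "runs (Store a e f) s (1 + acost e + acost f) (set_elem a (aval e s) (aval f s) s)"
| Seq: "runs c s t s' \<Longrightarrow> runs d s' u s'' \<Longrightarrow> runs (Seq c d) s (1 + t + u) s''"
| IfTrue: "bval b s \<Longrightarrow> runs c s t s' \<Longrightarrow> runs (If b c d) s (1 + bcost b + t) s'"
| IfFalse: "\<not> bval b s \<Longrightarrow> runs d s t s' \<Longrightarrow> runs (If b c d) s (1 + bcost b + t) s'"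
| WhileFalse: "\<not> bval b s \<Longrightarrow> runs (While b c) s (1 + bcost b) s"
| WhileTrue: "bval b s \<Longrightarrow> runs c s t s' \<Longrightarrow> runs (While b c) s' u s''
    \<Longrightarrow> runs (While b c) s (1 + bcost b + t + u) s''"

text \<open>Input: variables 0 and 1 hold the dimensions \<open>m\<close> and \<open>n\<close> of the matrix, array 0 its
  entries in row-major order, array 1 the coefficients of the chain; the rest of the memory is
  zero. Output: the first \<open>m\<close> elements of array 2.\<close>

definition input_state :: "int mat \<Rightarrow> int vec \<Rightarrow> state" where
  "input_state D c = State
     ((\<lambda>_. 0)(0 := int (dim_row D), 1 := int (dim_col D)))
     ((\<lambda>_ _. 0)(
        0 := (\<lambda>k. if 0 \<le> k \<and> k < int (dim_row D * dim_col D)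
                  then D $$ (nat k div dim_col D, nat k mod dim_col D) else 0),
        1 := (\<lambda>k. if 0 \<le> k \<and> k < int (dim_vec c) then c $ nat k else 0)))"

definition output_chain :: "nat \<Rightarrow> state \<Rightarrow> int vec" where
  "output_chain m s = vec m (\<lambda>i. arrays s 2 (int i))"

end

theory Submission
  imports Defs
begin

text \<open>Deciding whether some chain \<open>c + D y\<close> lies in an integral box and has \<open>1\<close>-norm at most
  \<open>K\<close> amounts to minimising a convex piecewise linear function of \<open>y\<close> with integral breakpoints
  (the norm plus a steep penalty for leaving the box). Total unimodularity makes the real minimum
  be attained at an integral point, so that it is an integer and an accuracy below 1 is enough.
  The subgradient method with a small constant step reaches this accuracy after polynomially many
  steps, because all data, slopes and the distance to an optimal point are polynomially bounded.
  Scaled by a common denominator it uses only additions, subtractions, multiplications and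
  comparisons of integers. An optimal chain is then obtained by fixing its coefficients one at a
  time.\<close>

section \<open>Integer solutions of totally unimodular systems\<close>

text \<open>On chains with values in {-1, 0, 1} the number of nonzero entries is the 1-norm, which
  is why a convex objective can stand for it. Rounding is not an elementary step of the machine, so
  the program never makes an integral point out of a fractional one: rounding happens only in the
  correctness proof. What the program does is compare a scaled objective value with a threshold,
  because a value below \<open>K + 1\<close> at a rational point forces an integral point of value
  at most \<open>K\<close>. The constants follow from this. The weight \<open>M = m + 1\<close>
  exceeds every norm bound \<open>K \<le> m\<close> that is tried, so that an integral point of
  value at most \<open>K\<close> cannot lie outside the box. \<open>N\<close> is at once the common
  denominator and a bound on the squared length of the subgradients; every iterate that fails the
  test then brings the next one closer to a feasible point by at least \<open>N\<close> in squared
  distance, and this limits the number of steps.\<close>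

definition tu_array :: "nat \<Rightarrow> nat \<Rightarrow> (nat \<Rightarrow> nat \<Rightarrow> int) \<Rightarrow> bool" where
  "tu_array m n D \<longleftrightarrow> (\<forall>k f g. (\<forall>a<k. f a < m) \<longrightarrow> (\<forall>b<k. g b < n)
     \<longrightarrow> det (mat k k (\<lambda>(a, b). D (f a) (g b))) \<in> {-1, 0, 1})"

text \<open>Two enumerations of the same rows differ by a permutation of the indices, extended by
  the identity as \<open>permutes\<close> demands; its sign disappears in the absolute
  value.\<close>

lemma abs_det_reindex_rows:
  fixes D :: "nat \<Rightarrow> nat \<Rightarrow> int"
  assumes f: "inj_on f {..<k}" and f': "inj_on f' {..<k}" and im: "f ` {..<k} = f' ` {..<k}"
  shows "\<bar>det (mat k k (\<lambda>(a, b). D (f a) b))\<bar> = \<bar>det (mat k k (\<lambda>(a, b). D (f' a) b))\<bar>"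
proof -
  define p where "p a = (if a < k then the_inv_into {..<k} f' (f a) else a)" for a
  have bb: "bij_betw (\<lambda>a. the_inv_into {..<k} f' (f a)) {..<k} {..<k}"
    using bij_betw_trans[of f "{..<k}" "f ` {..<k}" "the_inv_into {..<k} f'" "{..<k}"]
      bij_betw_the_inv_into[of f' "{..<k}" "f' ` {..<k}"] f f' im
    by (simp add: bij_betw_def comp_def)
  then have "bij_betw p {..<k} {..<k}"
    by (rule bij_betw_cong[THEN iffD1, rotated]) (simp add: p_def)
  then have "bij_betw p {0..<k} {0..<k}"
    by (simp add: lessThan_atLeast0)
  then have p: "p permutes {0..<k}"
    by (rule bij_imp_permutes) (simp add: p_def)
  have fp: "f a = f' (p a)" if "a < k" for a
    using that im f' by (auto simp: p_def intro!: f_the_inv_into_f[symmetric])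
  have pk: "p a < k" if "a < k" for a
    using permutes_in_image[OF p, of a] that by simp
  let ?A = "mat k k (\<lambda>(a, b). D (f' a) b)"
  have "mat k k (\<lambda>(a, b). D (f a) b) = mat k k (\<lambda>(a, b). ?A $$ (p a, b))"
    by (rule eq_matI) (auto simp: fp pk)
  then have "det (mat k k (\<lambda>(a, b). D (f a) b)) = signof p * det ?A"
    using det_permute_rows[OF _ p, of ?A] by simp
  then show ?thesis
    by (simp add: abs_mult sign_def)
qed

lemma det_mat_transpose:
  fixes D :: "nat \<Rightarrow> nat \<Rightarrow> 'a :: comm_ring_1"
  shows "det (mat k k (\<lambda>(a, b). D b a)) = det (mat k k (\<lambda>(a, b). D a b))"
proof -
  have "transpose_mat (mat k k (\<lambda>(a, b). D a b)) = mat k k (\<lambda>(a, b). D b a)"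
    by (rule eq_matI) auto
  then show ?thesis
    using det_transpose[of "mat k k (\<lambda>(a, b). D a b)" k] by simp
qed

lemma det_non_inj_rows:
  fixes D :: "nat \<Rightarrow> nat \<Rightarrow> 'a :: comm_ring_1"
  assumes "\<not> inj_on f {..<k}"
  shows "det (mat k k (\<lambda>(a, b). D (f a) b)) = 0"
proof -
  obtain a b where "a < k" "b < k" "a \<noteq> b" "f a = f b"
    using assms by (auto simp: inj_on_def)
  then show ?thesis
    by (intro det_identical_rows[of _ k a b]) (auto simp: row_def)
qed

lemma pick_image:
  assumes "finite I"
  shows "pick I ` {..<card I} = I" "inj_on (pick I) {..<card I}"
proof -
  show inj: "inj_on (pick I) {..<card I}"
    by (rule inj_onI) (metis lessThan_iff linorder_neqE_nat nat_neq_iff pick_mono_le)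
  show "pick I ` {..<card I} = I"
    using assms inj by (intro card_subset_eq) (auto simp: pick_in_set_le card_image)
qed

text \<open>Arbitrary index functions give no new minors: a repeated index makes the determinant
  vanish, and a change of order affects only its sign. In exchange, deleting or bordering rows and
  columns stays within the form of \<open>tu_array\<close>.\<close>

lemma totally_unimodular_tu_array:
  assumes "totally_unimodular A"
  shows "tu_array (dim_row A) (dim_col A) (\<lambda>i j. A $$ (i, j))"
  unfolding tu_array_def
proof (intro allI impI)
  fix k :: nat and f g
  assume f: "\<forall>a<k. f a < dim_row A" and g: "\<forall>b<k. g b < dim_col A"
  let ?d = "\<lambda>f g. det (mat k k (\<lambda>(a, b). A $$ (f a, g b)))"
  \<comment> \<open>Transposition turns selected columns into selected rows, so that the lemmas
    about rows serve both sides.\<close>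
  have T: "?d f g = det (mat k k (\<lambda>(a, b). A $$ (f b, g a)))" for f g
    using det_mat_transpose[of k "\<lambda>b a. A $$ (f b, g a)"] by simp
  show "?d f g \<in> {-1, 0, 1}"
  proof (cases "inj_on f {..<k} \<and> inj_on g {..<k}")
    case False
    then have "?d f g = 0"
      using det_non_inj_rows[of f k "\<lambda>i b. A $$ (i, g b)"]
        det_non_inj_rows[of g k "\<lambda>j a. A $$ (f a, j)"] T[of f g] by metis
    then show ?thesis by simp
  next
    case True
    define I J where "I = f ` {..<k}" and "J = g ` {..<k}"
    have card: "card I = k" "card J = k" and fin: "finite I" "finite J"
      using True by (auto simp: I_def J_def card_image)
    have sub: "I \<subseteq> {..<dim_row A}" "J \<subseteq> {..<dim_col A}"
      using f g by (auto simp: I_def J_def)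
    then have "{i. i < dim_row A \<and> i \<in> I} = I" "{j. j < dim_col A \<and> j \<in> J} = J"
      by auto
    then have "submatrix A I J = mat k k (\<lambda>(a, b). A $$ (pick I a, pick J b))"
      using card by (simp add: submatrix_def)
    then have tu: "?d (pick I) (pick J) \<in> {-1, 0, 1}"
      using assms[unfolded totally_unimodular_def, rule_format, of I J] sub card by simp
    have I: "inj_on (pick I) {..<k}" "f ` {..<k} = pick I ` {..<k}"
      and J: "inj_on (pick J) {..<k}" "g ` {..<k} = pick J ` {..<k}"
      using pick_image[OF fin(1)] pick_image[OF fin(2)] card I_def J_def by simp_all
    have "\<bar>?d f g\<bar> = \<bar>?d (pick I) g\<bar>"
      using abs_det_reindex_rows[OF _ I, of "\<lambda>i b. A $$ (i, g b)"] True by blast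
    also have "\<dots> = \<bar>?d (pick I) (pick J)\<bar>"
      using abs_det_reindex_rows[OF _ J, of "\<lambda>j a. A $$ (pick I a, j)"] True
      unfolding T by blast
    finally show ?thesis
      using tu by auto
  qed
qed

text \<open>Skipping one index is again a selection by index functions, so a cofactor is a minor up
  to sign.\<close>

lemma tu_array_cofactor:
  assumes tu: "tu_array m n D" and f: "\<forall>a<k. f a < m" and g: "\<forall>b<k. g b < n"
    and a: "a < k" and b: "b < k"
  shows "\<bar>cofactor (mat k k (\<lambda>(a, b). D (f a) (g b))) a b\<bar> \<le> 1"
proof -
  let ?f = "\<lambda>i. f (if i < a then i else Suc i)" and ?g = "\<lambda>j. g (if j < b then j else Suc j)"
  have "mat_delete (mat k k (\<lambda>(a, b). D (f a) (g b))) a b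
      = mat (k - 1) (k - 1) (\<lambda>(i, j). D (?f i) (?g j))"
    using a b by (intro eq_matI) (auto simp: mat_delete_def)
  moreover have "det (mat (k - 1) (k - 1) (\<lambda>(i, j). D (?f i) (?g j))) \<in> {-1, 0, 1}"
    using tu f g unfolding tu_array_def by (auto simp del: insert_iff)
  ultimately show ?thesis
    by (auto simp: cofactor_def abs_mult power_abs)
qed

text \<open>Basis rows: a nonzero minor of maximal order. Expanding the vanishing bordered minors
  along their last column writes every row as an integer combination of the basis rows.\<close>

lemma tu_array_basis:
  assumes tu: "tu_array m n D" and S: "S \<subseteq> {..<m}"
  obtains k f g where "k \<le> m" "\<forall>a<k. f a \<in> S" "\<forall>b<k. g b < n"
    "det (mat k k (\<lambda>(a, b). D (f a) (g b))) \<in> {-1, 1}"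
    "\<forall>i\<in>S. \<exists>q :: nat \<Rightarrow> int. \<forall>j<n. D i j = (\<Sum>a<k. q a * D (f a) j)"
proof -
  define P where "P k \<longleftrightarrow> (\<exists>f g. (\<forall>a<k. f a \<in> S) \<and> (\<forall>b<k. g b < n) \<and>
      det (mat k k (\<lambda>(a, b). D (f a) (g b))) \<noteq> 0)" for k :: nat
  have P0: "P 0" by (simp add: P_def)
  have Pm: "k \<le> m" if "P k" for k
  proof -
    obtain f g where fg: "\<forall>a<k. f a \<in> S" "det (mat k k (\<lambda>(a, b). D (f a) (g b))) \<noteq> 0"
      using \<open>P k\<close> unfolding P_def by blast
    \<comment> \<open>A nonvanishing minor has no repeated row. This bounds its order, so a maximal
      order exists.\<close>
    have "inj_on f {..<k}"
      using det_non_inj_rows[of f k "\<lambda>i b. D i (g b)"] fg by auto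
    then have "k \<le> card {..<m}"
      using card_inj_on_le[of f "{..<k}" "{..<m}"] fg S by auto
    then show ?thesis by simp
  qed
  define k where "k = (GREATEST k. P k)"
  have "P k" and max: "\<And>k'. P k' \<Longrightarrow> k' \<le> k"
    unfolding k_def using P0 Pm by (auto intro: GreatestI_nat[of P 0 m] Greatest_le_nat[of P _ m])
  then obtain f g where f: "\<forall>a<k. f a \<in> S" and g: "\<forall>b<k. g b < n"
    and d0: "det (mat k k (\<lambda>(a, b). D (f a) (g b))) \<noteq> 0"
    unfolding P_def by blast
  let ?d = "det (mat k k (\<lambda>(a, b). D (f a) (g b)))"
  have fm: "\<forall>a<k. f a < m"
    using f S by auto
  have d: "?d \<in> {-1, 1}"
    using d0 tu fm g unfolding tu_array_def by blast
  have "\<exists>q :: nat \<Rightarrow> int. \<forall>j<n. D i j = (\<Sum>a<k. q a * D (f a) j)" if i: "i \<in> S" for i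
  proof -
    define f' where "f' a = (if a < k then f a else i)" for a
    \<comment> \<open>The cofactors along the last column do not see its entries, hence the dummy 0
      there. The coefficients are thereby independent of the column \<open>j\<close>, and one
      \<open>q\<close> works for all columns.\<close>
    define C where "C a = cofactor (mat (Suc k) (Suc k)
       (\<lambda>(a, b). if b < k then D (f' a) (g b) else 0)) a k" for a
    have Ck: "C k = ?d"
    proof -
      have "mat_delete (mat (Suc k) (Suc k) (\<lambda>(a, b). if b < k then D (f' a) (g b) else 0)) k k
          = mat k k (\<lambda>(a, b). D (f a) (g b))"
        by (rule eq_matI) (auto simp: mat_delete_def f'_def)
      then show ?thesis by (simp add: C_def cofactor_def)
    qed
    have "(\<Sum>a<Suc k. D (f' a) j * C a) = 0" if j: "j < n" for j
    proof -
      define g' where "g' b = (if b < k then g b else j)" for b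
      let ?M = "mat (Suc k) (Suc k) (\<lambda>(a, b). D (f' a) (g' b))"
      have "\<not> P (Suc k)"
        using max[of "Suc k"] by auto
      moreover have "\<forall>a<Suc k. f' a \<in> S" "\<forall>b<Suc k. g' b < n"
        using f g i j by (auto simp: f'_def g'_def)
      ultimately have "det ?M = 0"
        unfolding P_def by blast
      moreover have "cofactor ?M a k = C a" if "a < Suc k" for a
      proof -
        have "mat_delete ?M a k = mat_delete (mat (Suc k) (Suc k)
            (\<lambda>(a, b). if b < k then D (f' a) (g b) else 0)) a k"
          by (rule eq_matI) (auto simp: mat_delete_def g'_def)
        then show ?thesis by (simp add: C_def cofactor_def)
      qed
      ultimately show ?thesis
        using laplace_expansion_column[of ?M "Suc k" k] by (simp add: g'_def)
    qed
    then have "D i j * ?d = - (\<Sum>a<k. D (f a) j * C a)" if "j < n" for j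
      using that by (force simp: f'_def Ck)
    \<comment> \<open>The minor is its own inverse, so the relation can be solved for row
      \<open>i\<close> over the integers.\<close>
    moreover have "?d * ?d = 1" using d by auto
    moreover have "x = y * e" if "x * e = y" "e * e = 1" for x y e :: int
      using that by (auto simp: mult.assoc)
    ultimately have "D i j = - (\<Sum>a<k. D (f a) j * C a) * ?d" if "j < n" for j
      using that by blast
    then have "\<forall>j<n. D i j = (\<Sum>a<k. (- C a * ?d) * D (f a) j)"
      by (auto simp: sum_distrib_right sum_negf mult_ac)
    then show ?thesis
      by (intro exI[of _ "\<lambda>a. - C a * ?d"]) blast
  qed
  with that[OF Pm[OF \<open>P k\<close>] f g d] show ?thesis
    by blast
qed

text \<open>Cramer's rule on a nonzero minor of maximal order, with all other variables set to 0, is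
  integral because the determinant is 1 or -1. The remaining rows of \<open>S\<close> are
  combinations of the basis rows. The size bound comes from the cofactors, which are at most 1 in
  absolute value.\<close>

lemma tu_array_integer_solution:
  fixes b :: "nat \<Rightarrow> int" and y :: "nat \<Rightarrow> real"
  assumes tu: "tu_array m n D" and S: "S \<subseteq> {..<m}"
    and y: "\<And>i. i \<in> S \<Longrightarrow> (\<Sum>j<n. real_of_int (D i j) * y j) = of_int (b i)"
    and b: "\<And>i. i \<in> S \<Longrightarrow> \<bar>b i\<bar> \<le> B" and "0 \<le> B"
  obtains z :: "nat \<Rightarrow> int" where "\<And>i. i \<in> S \<Longrightarrow> (\<Sum>j<n. D i j * z j) = b i"
    "\<And>j. \<bar>z j\<bar> \<le> int m * (int m * B)"
proof -
  obtain k f g where k: "k \<le> m" and f: "\<forall>a<k. f a \<in> S" and g: "\<forall>b<k. g b < n"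
    and d: "det (mat k k (\<lambda>(a, b). D (f a) (g b))) \<in> {-1, 1}"
    and comb: "\<forall>i\<in>S. \<exists>q :: nat \<Rightarrow> int. \<forall>j<n. D i j = (\<Sum>a<k. q a * D (f a) j)"
    by (rule tu_array_basis[OF tu S])
  let ?A = "mat k k (\<lambda>(a, b). D (f a) (g b))"
  have fm: "\<forall>a<k. f a < m" using f S by auto
  \<comment> \<open>Multiplying by \<open>det ?A\<close> amounts to dividing by it.\<close>
  define x where "x l = det ?A * (\<Sum>a<k. cofactor ?A a l * b (f a))" for l
  \<comment> \<open>Summing over all \<open>l\<close> with \<open>g l = j\<close> avoids an appeal
    to injectivity of \<open>g\<close>; the price is the second factor \<open>m\<close> in the
    bound.\<close>
  define z where "z j = (\<Sum>l<k. if g l = j then x l else 0)" for j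
  have Dz: "(\<Sum>j<n. D i j * z j) = (\<Sum>l<k. D i (g l) * x l)" for i
  proof -
    have "(\<Sum>j<n. D i j * z j) = (\<Sum>l<k. \<Sum>j<n. if j = g l then D i (g l) * x l else 0)"
      unfolding z_def sum_distrib_left by (subst sum.swap) (auto intro!: sum.cong)
    also have "\<dots> = (\<Sum>l<k. D i (g l) * x l)"
      using g by (intro sum.cong) (auto simp: sum.delta)
    finally show ?thesis .
  qed
  have sol: "(\<Sum>l<k. D (f a) (g l) * x l) = b (f a)" if a: "a < k" for a
  proof -
    have adj: "(\<Sum>l<k. D (f a) (g l) * cofactor ?A a' l) = (if a = a' then det ?A else 0)"
      if a': "a' < k" for a'
    proof -
      have "(?A * adj_mat ?A) $$ (a, a') = (det ?A \<cdot>\<^sub>m 1\<^sub>m k) $$ (a, a')"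
        using adj_mat(2)[of ?A k] by simp
      moreover have "(?A * adj_mat ?A) $$ (a, a') = (\<Sum>l<k. D (f a) (g l) * cofactor ?A a' l)"
        using a a' by (simp add: adj_mat_def scalar_prod_def lessThan_atLeast0)
      ultimately show ?thesis using a a' by simp
    qed
    have "(\<Sum>l<k. D (f a) (g l) * x l)
        = (\<Sum>l<k. \<Sum>a'<k. det ?A * b (f a') * (D (f a) (g l) * cofactor ?A a' l))"
      unfolding x_def by (simp add: sum_distrib_left algebra_simps)
    also have "\<dots> = (\<Sum>a'<k. det ?A * b (f a') * (\<Sum>l<k. D (f a) (g l) * cofactor ?A a' l))"
      by (subst sum.swap) (simp add: sum_distrib_left)
    also have "\<dots> = (\<Sum>a'<k. if a' = a then det ?A * b (f a) * det ?A else 0)"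
      by (intro sum.cong) (auto simp: adj)
    also have "\<dots> = b (f a)"
      using a d by (auto simp: sum.delta)
    finally show ?thesis .
  qed
  show thesis
  proof
    fix i assume i: "i \<in> S"
    obtain q :: "nat \<Rightarrow> int" where q: "\<forall>j<n. D i j = (\<Sum>a<k. q a * D (f a) j)"
      using comb i by blast
    have "(\<Sum>j<n. D i j * z j) = (\<Sum>l<k. \<Sum>a<k. q a * (D (f a) (g l) * x l))"
      unfolding Dz using q g by (intro sum.cong) (auto simp: sum_distrib_right mult.assoc)
    also have "\<dots> = (\<Sum>a<k. q a * (\<Sum>l<k. D (f a) (g l) * x l))"
      by (subst sum.swap) (simp add: sum_distrib_left)
    also have "\<dots> = (\<Sum>a<k. q a * b (f a))"
      by (intro sum.cong) (auto simp: sol)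
    finally have 1: "(\<Sum>j<n. D i j * z j) = (\<Sum>a<k. q a * b (f a))" .
    \<comment> \<open>The real solution shows that the right-hand sides obey the same linear
      relation as the rows.\<close>
    have "real_of_int (b i) = (\<Sum>j<n. real_of_int (D i j) * y j)"
      using y[OF i] by simp
    also have "\<dots> = (\<Sum>j<n. \<Sum>a<k. real_of_int (q a) * (of_int (D (f a) j) * y j))"
      using q by (intro sum.cong) (auto simp: sum_distrib_right mult.assoc)
    also have "\<dots> = (\<Sum>a<k. real_of_int (q a) * (\<Sum>j<n. of_int (D (f a) j) * y j))"
      by (subst sum.swap) (simp add: sum_distrib_left)
    also have "\<dots> = (\<Sum>a<k. real_of_int (q a) * of_int (b (f a)))"
      using f y by (intro sum.cong) auto
    also have "\<dots> = of_int (\<Sum>a<k. q a * b (f a))" by simp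
    finally show "(\<Sum>j<n. D i j * z j) = b i"
      using 1 by linarith
  next
    fix j
    have x: "\<bar>x l\<bar> \<le> int m * B" if "l < k" for l
    proof -
      have "\<bar>x l\<bar> = \<bar>\<Sum>a<k. cofactor ?A a l * b (f a)\<bar>"
        using d by (auto simp: x_def abs_mult)
      also have "\<dots> \<le> (\<Sum>a<k. \<bar>cofactor ?A a l * b (f a)\<bar>)" by (rule sum_abs)
      also have "\<dots> \<le> (\<Sum>a<k. B)"
      proof (rule sum_mono)
        fix a assume "a \<in> {..<k}"
        then have "\<bar>cofactor ?A a l\<bar> \<le> 1" "\<bar>b (f a)\<bar> \<le> B"
          using tu_array_cofactor[OF tu fm g] \<open>l < k\<close> b f by auto
        then show "\<bar>cofactor ?A a l * b (f a)\<bar> \<le> B"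
          using mult_mono[of "\<bar>cofactor ?A a l\<bar>" 1 "\<bar>b (f a)\<bar>" B] by (simp add: abs_mult)
      qed
      also have "\<dots> \<le> int m * B"
        using k \<open>0 \<le> B\<close> by (simp add: mult_right_mono)
      finally show ?thesis .
    qed
    have "\<bar>z j\<bar> \<le> (\<Sum>l<k. \<bar>if g l = j then x l else 0\<bar>)"
      unfolding z_def by (rule sum_abs)
    also have "\<dots> \<le> (\<Sum>l<k. int m * B)"
      using x \<open>0 \<le> B\<close> by (intro sum_mono) auto
    also have "\<dots> \<le> int m * (int m * B)"
      using k \<open>0 \<le> B\<close> by (simp add: mult_right_mono)
    finally show "\<bar>z j\<bar> \<le> int m * (int m * B)" .
  qed
qed

section \<open>Rounding\<close>

text \<open>The cells are closed: a coordinate that has just become integral still obeys the affine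
  formula of the cell it came from.\<close>

definition int_affine :: "(real \<Rightarrow> real) \<Rightarrow> bool" where
  "int_affine g \<longleftrightarrow> (\<forall>k :: int. \<exists>a b. \<forall>t\<in>{of_int k..of_int k + 1}. g t = a + b * t)"

lemma int_affine_abs: "int_affine abs"
  unfolding int_affine_def
proof
  fix k :: int
  show "\<exists>a b. \<forall>t\<in>{of_int k..of_int k + 1}. \<bar>t :: real\<bar> = a + b * t"
    by (cases "0 \<le> k") (rule exI[of _ 0], rule exI[of _ "if 0 \<le> k then 1 else -1"], auto)+
qed

lemma int_affine_max:
  "int_affine (\<lambda>t. max 0 (t - of_int c))" "int_affine (\<lambda>t. max 0 (of_int c - t))"
proof -
  \<comment> \<open>The integer \<open>c\<close> never falls inside a cell, so on each cell the
    maximum is given by a single branch.\<close>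
  have *: "of_int k + 1 \<le> (of_int c :: real) \<or> (of_int c :: real) \<le> of_int k" for k :: int
  proof -
    have "k + 1 \<le> c \<or> c \<le> k" by linarith
    then show ?thesis by linarith
  qed
  show "int_affine (\<lambda>t. max 0 (t - of_int c))"
    unfolding int_affine_def
  proof
    fix k :: int
    show "\<exists>a b. \<forall>t\<in>{of_int k..of_int k + 1}. max 0 (t - of_int c :: real) = a + b * t"
      by (rule exI[of _ "if c \<le> k then - of_int c else 0"], rule exI[of _ "if c \<le> k then 1 else 0"])
        (use *[of k] in auto)
  qed
  show "int_affine (\<lambda>t. max 0 (of_int c - t))"
    unfolding int_affine_def
  proof
    fix k :: int
    show "\<exists>a b. \<forall>t\<in>{of_int k..of_int k + 1}. max 0 (of_int c - t :: real) = a + b * t"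
      by (rule exI[of _ "if c \<le> k then 0 else of_int c"], rule exI[of _ "if c \<le> k then 0 else -1"])
        (use *[of k] in auto)
  qed
qed

lemma int_affine_add:
  assumes "int_affine f" "int_affine g"
  shows "int_affine (\<lambda>t. f t + g t)"
  unfolding int_affine_def
proof
  fix k :: int
  obtain a b a' b' where "\<forall>t\<in>{of_int k..of_int k + 1}. f t = a + b * t"
    "\<forall>t\<in>{of_int k..of_int k + 1}. g t = a' + b' * t"
    using assms unfolding int_affine_def by metis
  then show "\<exists>a b. \<forall>t\<in>{of_int k..of_int k + 1}. f t + g t = a + b * t"
    by (intro exI[of _ "a + a'"] exI[of _ "b + b'"]) (auto simp: algebra_simps)
qed

lemma int_affine_cmult:
  assumes "int_affine f"
  shows "int_affine (\<lambda>t. r * f t)"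
  unfolding int_affine_def
proof
  fix k :: int
  obtain a b where "\<forall>t\<in>{of_int k..of_int k + 1}. f t = a + b * t"
    using assms unfolding int_affine_def by metis
  then show "\<exists>a b. \<forall>t\<in>{of_int k..of_int k + 1}. r * f t = a + b * t"
    by (intro exI[of _ "r * a"] exI[of _ "r * b"]) (auto simp: algebra_simps)
qed

text \<open>As long as no coordinate crosses an integer the objective is affine along a line, so it
  does not increase in one of the two directions; the move ends when a further coordinate
  becomes integral.\<close>

lemma move_to_integer:
  fixes t u :: "nat \<Rightarrow> real"
  assumes g: "\<And>i. i < m \<Longrightarrow> int_affine (g i)"
    and u0: "\<And>i. i < m \<Longrightarrow> t i \<in> \<int> \<Longrightarrow> u i = 0" and u: "i0 < m" "u i0 \<noteq> 0"
  obtains x i1 where "(\<Sum>i<m. g i (t i + x * u i)) \<le> (\<Sum>i<m. g i (t i))"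
    "i1 < m" "t i1 \<notin> \<int>" "t i1 + x * u i1 \<in> \<int>"
proof -
  have "\<forall>i. \<exists>b. i < m \<longrightarrow>
      (\<forall>s\<in>{of_int \<lfloor>t i\<rfloor>..of_int \<lfloor>t i\<rfloor> + 1}. g i s = g i (t i) + b * (s - t i))"
  proof
    fix i
    show "\<exists>b. i < m \<longrightarrow> 
      (\<forall>s\<in>{of_int \<lfloor>t i\<rfloor>..of_int \<lfloor>t i\<rfloor> + 1}. g i s = g i (t i) + b * (s - t i))"
    proof (cases "i < m")
      case True
      then obtain a b where ab: "\<forall>s\<in>{of_int \<lfloor>t i\<rfloor>..of_int \<lfloor>t i\<rfloor> + 1}. g i s = a + b * s"
        using g unfolding int_affine_def by blast
      moreover have "t i \<in> {of_int \<lfloor>t i\<rfloor>..of_int \<lfloor>t i\<rfloor> + 1}"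
        by (auto intro: less_imp_le)
      ultimately have "g i (t i) = a + b * t i" by blast
      with ab show ?thesis
        by (intro exI[of _ b]) (auto simp: algebra_simps)
    qed auto
  qed
  then obtain b where b: "\<And>i s. i < m \<Longrightarrow> s \<in> {of_int \<lfloor>t i\<rfloor>..of_int \<lfloor>t i\<rfloor> + 1}
      \<Longrightarrow> g i s = g i (t i) + b i * (s - t i)"
    by metis
  \<comment> \<open>The sign selects the direction in which the sum of the affine pieces does not
    increase.\<close>
  define e :: real where "e = (if (\<Sum>i<m. b i * u i) \<le> 0 then 1 else -1)"
  define v where "v i = e * u i" for i
  have slope: "(\<Sum>i<m. b i * v i) \<le> 0"
    by (auto simp: v_def e_def sum_negf)
  define I where "I = {i. i < m \<and> u i \<noteq> 0}"
  have v: "v i \<noteq> 0" "t i \<notin> \<int>" if "i \<in> I" for i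
    using that u0 by (auto simp: I_def v_def e_def)
  \<comment> \<open>The time at which coordinate \<open>i\<close>, moving with velocity
    \<open>v i\<close>, reaches the end of its cell. Up to the least of these times every coordinate
    stays in its cell.\<close>
  define r where "r i = ((if v i > 0 then of_int \<lfloor>t i\<rfloor> + 1 else of_int \<lfloor>t i\<rfloor>) - t i) / v i" for i
  have bounds: "of_int \<lfloor>t i\<rfloor> < t i" "t i < of_int \<lfloor>t i\<rfloor> + 1" if "i \<in> I" for i
    using v[OF that] by (metis Ints_of_int of_int_floor_le order_le_less, linarith)
  have "finite I" "I \<noteq> {}"
    using u by (auto simp: I_def)
  then have "Min (r ` I) \<in> r ` I"
    by (intro Min_in) auto
  then obtain i1 where i1: "i1 \<in> I" "Min (r ` I) = r i1" by auto
  have rmin: "r i1 \<le> r i" if "i \<in> I" for i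
    using \<open>finite I\<close> that unfolding i1(2)[symmetric] by (intro Min_le) auto
  have rpos: "0 < r i" if "i \<in> I" for i
    using bounds[OF that] v[OF that]
    by (cases "0 < v i") (auto simp: r_def intro!: divide_pos_pos divide_neg_neg)
  have "t i + r i1 * v i \<in> {of_int \<lfloor>t i\<rfloor>..of_int \<lfloor>t i\<rfloor> + 1}" if "i < m" for i
  proof (cases "i \<in> I")
    case True
    show ?thesis
    proof (cases "0 < v i")
      case True
      with rmin[OF \<open>i \<in> I\<close>] rpos[OF i1(1)] have "0 \<le> r i1 * v i" "r i1 * v i \<le> r i * v i"
        by (auto intro: mult_right_mono)
      moreover have "r i * v i = of_int \<lfloor>t i\<rfloor> + 1 - t i"
        using True by (simp add: r_def)
      ultimately show ?thesis
        using bounds[OF \<open>i \<in> I\<close>] unfolding atLeastAtMost_iff by linarith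
    next
      case False
      with rmin[OF \<open>i \<in> I\<close>] rpos[OF i1(1)] have "r i1 * v i \<le> 0" "r i * v i \<le> r i1 * v i"
        by (auto intro: mult_right_mono_neg simp: mult_le_0_iff)
      moreover have "r i * v i = of_int \<lfloor>t i\<rfloor> - t i"
        using False v[OF \<open>i \<in> I\<close>] by (simp add: r_def)
      ultimately show ?thesis
        using bounds[OF \<open>i \<in> I\<close>] unfolding atLeastAtMost_iff by linarith
    qed
  next
    case False
    with that have "v i = 0" by (auto simp: I_def v_def)
    then show ?thesis by (auto intro: less_imp_le)
  qed
  then have "g i (t i + r i1 * v i) = g i (t i) + r i1 * (b i * v i)" if "i < m" for i
    using b[of i "t i + r i1 * v i"] that by simp
  then have "(\<Sum>i<m. g i (t i + r i1 * v i)) = (\<Sum>i<m. g i (t i) + r i1 * (b i * v i))"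
    by (intro sum.cong) auto
  also have "\<dots> = (\<Sum>i<m. g i (t i)) + r i1 * (\<Sum>i<m. b i * v i)"
    by (simp add: sum.distrib sum_distrib_left)
  also have "\<dots> \<le> (\<Sum>i<m. g i (t i))"
    using slope rpos[OF i1(1)] by (simp add: mult_nonneg_nonpos)
  finally have dec: "(\<Sum>i<m. g i (t i + (r i1 * e) * u i)) \<le> (\<Sum>i<m. g i (t i))"
    by (simp add: v_def mult.assoc)
  have "t i1 + r i1 * v i1 = (if v i1 > 0 then of_int \<lfloor>t i1\<rfloor> + 1 else of_int \<lfloor>t i1\<rfloor>)"
    using v[OF i1(1)] by (simp add: r_def)
  then have "t i1 + (r i1 * e) * u i1 \<in> \<int>"
    by (simp add: v_def mult.assoc)
  with dec i1(1) v[OF i1(1)] show thesis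
    by (intro that[of "r i1 * e" i1]) (auto simp: I_def)
qed

text \<open>Among the points that are no worse than \<open>y\<close>, one with the most integral
  image coordinates is taken. If a direction fixed these coordinates but moved another one,
  \<open>move_to_integer\<close> would make one more integral. So they determine the whole image,
  and an integer solution of the equations for them has the same image, hence the same
  value.\<close>

lemma tu_array_rounding:
  fixes y :: "nat \<Rightarrow> real" and c :: "nat \<Rightarrow> int"
  assumes tu: "tu_array m n D" and g: "\<And>i. i < m \<Longrightarrow> int_affine (g i)"
  obtains z :: "nat \<Rightarrow> int" where
    "(\<Sum>i<m. g i (of_int (c i + (\<Sum>j<n. D i j * z j))))
      \<le> (\<Sum>i<m. g i (of_int (c i) + (\<Sum>j<n. of_int (D i j) * y j)))"
proof -
  define t where "t y i = of_int (c i) + (\<Sum>j<n. of_int (D i j) * y j)" for y :: "nat \<Rightarrow> real" and i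
  define S where "S y = {i. i < m \<and> t y i \<in> \<int>}" for y
  define Q where "Q y' \<longleftrightarrow> (\<Sum>i<m. g i (t y' i)) \<le> (\<Sum>i<m. g i (t y i))" for y'
  have bound: "card (S y') < Suc m" for y'
    using card_mono[of "{..<m}" "S y'"] by (auto simp: S_def less_Suc_eq_le)
  obtain y' where Qy': "Q y'" and max: "\<And>y''. Q y'' \<Longrightarrow> card (S y'') \<le> card (S y')"
    using ex_has_greatest_nat[of Q y "\<lambda>y. card (S y)" "Suc m"] bound by (auto simp: Q_def)
  have spanning: "(\<Sum>j<n. of_int (D i j) * d j) = 0"
    if d: "\<And>i. i \<in> S y' \<Longrightarrow> (\<Sum>j<n. of_int (D i j) * d j) = 0" and "i < m" for d :: "nat \<Rightarrow> real" and i
  proof (rule ccontr)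
    define u where "u i = (\<Sum>j<n. of_int (D i j) * d j)" for i
    assume "(\<Sum>j<n. of_int (D i j) * d j) \<noteq> 0"
    then have ui: "u i \<noteq> 0" by (simp add: u_def)
    have u0: "u i = 0" if "i < m" "t y' i \<in> \<int>" for i
      using d[of i] that by (simp add: S_def u_def)
    obtain x i1 where x: "(\<Sum>i<m. g i (t y' i + x * u i)) \<le> (\<Sum>i<m. g i (t y' i))"
      and i1: "i1 < m" "t y' i1 \<notin> \<int>" "t y' i1 + x * u i1 \<in> \<int>"
      by (rule move_to_integer[of m g "t y'" u i, OF g u0 \<open>i < m\<close> ui])
    define y'' where "y'' j = y' j + x * d j" for j
    have t'': "t y'' i = t y' i + x * u i" for i
      by (simp add: t_def u_def y''_def algebra_simps sum.distrib sum_distrib_left)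
    then have "Q y''"
      using x Qy' by (simp add: Q_def)
    moreover have "S y' \<subset> S y''"
      using i1 u0 by (auto simp: S_def t'')
    then have "card (S y') < card (S y'')"
      by (intro psubset_card_mono) (auto simp: S_def)
    ultimately show False
      using max by fastforce
  qed
  define b where "b i = \<lfloor>t y' i\<rfloor> - c i" for i
  have b: "(\<Sum>j<n. of_int (D i j) * y' j) = of_int (b i)" if "i \<in> S y'" for i
    using that by (auto simp: S_def b_def t_def elim!: Ints_cases)
  have S: "S y' \<subseteq> {..<m}" by (auto simp: S_def)
  define B where "B = Max (insert 0 ((\<lambda>i. \<bar>b i\<bar>) ` {..<m}))"
  have bB: "\<bar>b i\<bar> \<le> B" if "i \<in> S y'" for i
    using that S unfolding B_def by (intro Max_ge) auto
  have B: "0 \<le> B"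
    unfolding B_def by (intro Max_ge) auto
  obtain z :: "nat \<Rightarrow> int" where z: "\<And>i. i \<in> S y' \<Longrightarrow> (\<Sum>j<n. D i j * z j) = b i"
    using tu_array_integer_solution[OF tu S b bB B] by blast
  have "(\<Sum>j<n. of_int (D i j) * (of_int (z j) - y' j)) = 0" if "i < m" for i
  proof (rule spanning[OF _ that])
    fix i assume i: "i \<in> S y'"
    have "real_of_int (\<Sum>j<n. D i j * z j) = of_int (b i)"
      using z[OF i] by simp
    then show "(\<Sum>j<n. of_int (D i j) * (of_int (z j) - y' j)) = 0"
      using b[OF i] by (simp add: algebra_simps sum_subtractf)
  qed
  then have "of_int (c i + (\<Sum>j<n. D i j * z j)) = t y' i" if "i < m" for i
    using that by (simp add: t_def algebra_simps sum_subtractf)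
  then have "(\<Sum>i<m. g i (of_int (c i + (\<Sum>j<n. D i j * z j)))) = (\<Sum>i<m. g i (t y' i))"
    by (intro sum.cong) auto
  then show thesis
    using that[of z] Qy' by (simp add: Q_def t_def)
qed

section \<open>The subgradient method\<close>

definition penalty :: "int \<Rightarrow> int \<Rightarrow> int \<Rightarrow> int \<Rightarrow> int" where
  "penalty M l h t = \<bar>t\<bar> + M * max 0 (t - h) + M * max 0 (l - t)"

text \<open>A subgradient of \<open>penalty\<close>. At a kink every value between the one-sided
  slopes would do; the choice is 1 at 0 and no contribution of the penalty at \<open>l\<close> and
  \<open>h\<close>.\<close>

definition slope :: "int \<Rightarrow> int \<Rightarrow> int \<Rightarrow> int \<Rightarrow> int" where
  "slope M l h t = (if t < 0 then -1 else 1) + (if h < t then M else 0) - (if t < l then M else 0)"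

lemma penalty_subgradient:
  assumes "0 \<le> M"
  shows "penalty M l h t + slope M l h t * (t' - t) \<le> penalty M l h t'"
proof -
  have 1: "\<bar>t\<bar> + (if t < 0 then -1 else 1) * (t' - t) \<le> \<bar>t'\<bar>"
    by auto
  have "max 0 (t - h) + (if h < t then 1 else 0) * (t' - t) \<le> max 0 (t' - h)"
    by auto
  from mult_left_mono[OF this assms]
  have 2: "M * max 0 (t - h) + (if h < t then M else 0) * (t' - t) \<le> M * max 0 (t' - h)"
    by (simp add: algebra_simps split: if_splits)
  have "max 0 (l - t) - (if t < l then 1 else 0) * (t' - t) \<le> max 0 (l - t')"
    by auto
  from mult_left_mono[OF this assms]
  have 3: "M * max 0 (l - t) - (if t < l then M else 0) * (t' - t) \<le> M * max 0 (l - t')"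
    by (simp add: algebra_simps split: if_splits)
  have eq: "slope M l h t * (t' - t) = (if t < 0 then -1 else 1) * (t' - t)
      + (if h < t then M else 0) * (t' - t) - (if t < l then M else 0) * (t' - t)"
    unfolding slope_def by (simp only: distrib_right left_diff_distrib)
  show ?thesis
    unfolding eq penalty_def using 1 2 3 by linarith
qed

lemma abs_slope_le:
  assumes "0 \<le> M" "l \<le> h"
  shows "\<bar>slope M l h t\<bar> \<le> M + 1"
  using assms by (auto simp: slope_def)

text \<open>Positive homogeneity, which allows objective values of rational points to be compared in
  integers.\<close>

lemma penalty_scale:
  assumes "0 \<le> N"
  shows "penalty M (N * l) (N * h) (N * t) = N * penalty M l h t"
proof -
  have mx: "max 0 (N * a - N * b) = N * max 0 (a - b)" for a b
    using assms by (simp add: max_mult_distrib_left right_diff_distrib)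
  have ab: "\<bar>N * t\<bar> = N * \<bar>t\<bar>"
    using assms by (simp add: abs_mult)
  show ?thesis
    unfolding penalty_def mx ab by (simp add: distrib_left mult.left_commute)
qed

lemma penalty_nonneg: "0 \<le> M \<Longrightarrow> 0 \<le> penalty M l h t"
  by (simp add: penalty_def)

lemma penalty_outside:
  assumes "0 \<le> M" "\<not> (l \<le> t \<and> t \<le> h)"
  shows "M \<le> penalty M l h t"
proof -
  have "1 \<le> max 0 (t - h) + max 0 (l - t)"
    using assms by auto
  from mult_left_mono[OF this assms(1)] show ?thesis
    by (simp add: penalty_def distrib_left)
qed

lemma penalty_inside: "l \<le> t \<Longrightarrow> t \<le> h \<Longrightarrow> penalty M l h t = \<bar>t\<bar>"
  by (simp add: penalty_def)

section \<open>Chains in a box: the descent and its analysis\<close>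

text \<open>Nothing is assumed, so that the locale can be interpreted for whatever bounds
  \<open>lo\<close> and \<open>hi\<close> the search has reached.\<close>

locale box_problem =
  fixes m n :: nat and D :: "nat \<Rightarrow> nat \<Rightarrow> int" and c lo hi :: "nat \<Rightarrow> int" and M N :: int
begin

text \<open>The factor \<open>r\<close> is the common denominator: \<open>img 1 y\<close> is the
  chain itself, and \<open>img N Y\<close> is \<open>N\<close> times the chain of the point
  \<open>Y / N\<close>.\<close>

definition img :: "int \<Rightarrow> (nat \<Rightarrow> int) \<Rightarrow> nat \<Rightarrow> int" where
  "img r y i = r * c i + (\<Sum>j<n. D i j * y j)"

definition feasible :: "int \<Rightarrow> (nat \<Rightarrow> int) \<Rightarrow> bool" where
  "feasible K y \<longleftrightarrow> (\<forall>i<m. lo i \<le> img 1 y i \<and> img 1 y i \<le> hi i) \<and> (\<Sum>i<m. \<bar>img 1 y i\<bar>) \<le> K"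

text \<open>An integral iterate \<open>Y\<close> stands for the rational point \<open>Y / N\<close>; the step length of the
  subgradient method is \<open>1 / N\<close>.\<close>

definition objective :: "(nat \<Rightarrow> int) \<Rightarrow> int" where
  "objective Y = (\<Sum>i<m. penalty M (N * lo i) (N * hi i) (img N Y i))"

definition slope_at :: "(nat \<Rightarrow> int) \<Rightarrow> nat \<Rightarrow> int" where
  "slope_at Y i = slope M (N * lo i) (N * hi i) (img N Y i)"

definition descend :: "(nat \<Rightarrow> int) \<Rightarrow> nat \<Rightarrow> int" where
  "descend Y j = Y j - (\<Sum>i<m. D i j * slope_at Y i)"

definition iterate :: "nat \<Rightarrow> nat \<Rightarrow> int" where
  "iterate k = (descend ^^ k) (\<lambda>_. 0)"

lemma img_scale: "img N (\<lambda>j. N * y j) i = N * img 1 y i"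
  by (simp add: img_def distrib_left sum_distrib_left mult.left_commute)

text \<open>In scaled coordinates a step of length \<open>1 / N\<close> subtracts exactly the
  subgradient \<open>G\<close>. When the square is expanded, convexity bounds the linear term by the
  gap of the objective values; each entry of \<open>G\<close> is at most \<open>m * (M + 1)\<close>
  in absolute value, so by \<open>big\<close> the quadratic term is at most
  \<open>N\<close>.\<close>

lemma descend_distance:
  assumes "0 \<le> M" "0 \<le> N" and D: "\<And>i j. i < m \<Longrightarrow> j < n \<Longrightarrow> \<bar>D i j\<bar> \<le> 1"
    and box: "\<And>i. i < m \<Longrightarrow> lo i \<le> hi i"
    and big: "int n * (int m * (M + 1))\<^sup>2 \<le> N"
  shows "(\<Sum>j<n. (descend Y j - Z j)\<^sup>2) \<le> (\<Sum>j<n. (Y j - Z j)\<^sup>2) - 2 * (objective Y - objective Z) + N"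
proof -
  define s where "s = slope_at Y"
  define G where "G j = (\<Sum>i<m. D i j * s i)" for j
  have "objective Y - objective Z \<le> (\<Sum>i<m. s i * (img N Y i - img N Z i))"
    unfolding objective_def sum_subtractf[symmetric]
  proof (rule sum_mono)
    fix i
    show "penalty M (N * lo i) (N * hi i) (img N Y i) - penalty M (N * lo i) (N * hi i) (img N Z i)
        \<le> s i * (img N Y i - img N Z i)"
      using penalty_subgradient[OF \<open>0 \<le> M\<close>, of "N * lo i" "N * hi i" "img N Y i" "img N Z i"]
      unfolding s_def slope_at_def right_diff_distrib by linarith
  qed
  also have "\<dots> = (\<Sum>i<m. \<Sum>j<n. D i j * s i * (Y j - Z j))"
    by (simp add: img_def sum_subtractf sum_distrib_left right_diff_distrib mult_ac)
  also have "\<dots> = (\<Sum>j<n. G j * (Y j - Z j))"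
    unfolding G_def sum_distrib_right by (rule sum.swap)
  finally have 1: "objective Y - objective Z \<le> (\<Sum>j<n. G j * (Y j - Z j))" .
  have "(\<Sum>j<n. (G j)\<^sup>2) \<le> (\<Sum>j<n. (int m * (M + 1))\<^sup>2)"
  proof (rule sum_mono)
    fix j assume j: "j \<in> {..<n}"
    have "\<bar>G j\<bar> \<le> (\<Sum>i<m. \<bar>D i j * s i\<bar>)"
      unfolding G_def by (rule sum_abs)
    also have "\<dots> \<le> (\<Sum>i<m. M + 1)"
    proof (rule sum_mono)
      fix i assume i: "i \<in> {..<m}"
      have "\<bar>s i\<bar> \<le> M + 1"
        unfolding s_def slope_at_def using assms i
        by (intro abs_slope_le) (auto intro: mult_left_mono)
      then show "\<bar>D i j * s i\<bar> \<le> M + 1"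
        using D[of i j] i j mult_mono[of "\<bar>D i j\<bar>" 1 "\<bar>s i\<bar>" "M + 1"] by (simp add: abs_mult)
    qed
    finally have "\<bar>G j\<bar> \<le> int m * (M + 1)" by simp
    then show "(G j)\<^sup>2 \<le> (int m * (M + 1))\<^sup>2"
      using \<open>0 \<le> M\<close> by (intro abs_le_square_iff[THEN iffD1]) simp
  qed
  then have 2: "(\<Sum>j<n. (G j)\<^sup>2) \<le> N"
    using big by simp
  have "(\<Sum>j<n. (descend Y j - Z j)\<^sup>2)
      = (\<Sum>j<n. (Y j - Z j)\<^sup>2 - 2 * (G j * (Y j - Z j)) + (G j)\<^sup>2)"
    by (intro sum.cong) (auto simp: descend_def G_def s_def power2_eq_square algebra_simps)
  also have "\<dots> = (\<Sum>j<n. (Y j - Z j)\<^sup>2) - 2 * (\<Sum>j<n. G j * (Y j - Z j)) + (\<Sum>j<n. (G j)\<^sup>2)"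
    by (simp add: sum.distrib sum_subtractf sum_distrib_left)
  finally have 3: "(\<Sum>j<n. (descend Y j - Z j)\<^sup>2)
      = (\<Sum>j<n. (Y j - Z j)\<^sup>2) - 2 * (\<Sum>j<n. G j * (Y j - Z j)) + (\<Sum>j<n. (G j)\<^sup>2)" .
  have "a = b - 2 * g + q \<Longrightarrow> w \<le> g \<Longrightarrow> q \<le> N \<Longrightarrow> a \<le> b - 2 * w + N" for a b g q w :: int
    by linarith
  from this[OF 3 1 2] show ?thesis .
qed

text \<open>The scaled feasible point \<open>Z\<close> has objective at most \<open>N * K\<close>.
  If all iterates stayed at \<open>N * (K + 1)\<close> or above, the gap would always be at least
  \<open>N\<close>, and each step would lower the squared distance to \<open>Z\<close> by at least
  \<open>N\<close>. It starts at no more than \<open>N\<^sup>2 * n * R\<^sup>2\<close>, so after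
  \<open>T\<close> steps it would be negative.\<close>

lemma descent_complete:
  assumes "0 \<le> M" "0 < N" and D: "\<And>i j. i < m \<Longrightarrow> j < n \<Longrightarrow> \<bar>D i j\<bar> \<le> 1"
    and box: "\<And>i. i < m \<Longrightarrow> lo i \<le> hi i"
    and big: "int n * (int m * (M + 1))\<^sup>2 \<le> N"
    and y: "feasible K y" "\<And>j. \<bar>y j\<bar> \<le> R" and T: "N * (int n * R\<^sup>2) < int T"
  shows "\<exists>k<T. objective (iterate k) < N * (K + 1)"
proof (rule ccontr)
  assume "\<not> ?thesis"
  then have bad: "N * (K + 1) \<le> objective (iterate k)" if "k < T" for k
    using that by (meson linorder_not_less)
  define Z where "Z j = N * y j" for j
  have "objective Z = (\<Sum>i<m. N * \<bar>img 1 y i\<bar>)"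
    unfolding objective_def
  proof (rule sum.cong)
    fix i assume "i \<in> {..<m}"
    moreover have "img N Z i = N * img 1 y i"
      using img_scale[of y i] by (simp add: Z_def[abs_def])
    ultimately show "penalty M (N * lo i) (N * hi i) (img N Z i) = N * \<bar>img 1 y i\<bar>"
      using y(1) \<open>0 < N\<close> by (simp add: penalty_scale penalty_inside feasible_def abs_mult)
  qed simp
  also have "\<dots> = N * (\<Sum>i<m. \<bar>img 1 y i\<bar>)"
    by (simp add: sum_distrib_left)
  also have "\<dots> \<le> N * K"
    using y(1) \<open>0 < N\<close> by (simp add: feasible_def)
  finally have Z: "objective Z \<le> N * K" .
  have dist: "(\<Sum>j<n. (iterate k j - Z j)\<^sup>2) \<le> (\<Sum>j<n. (Z j)\<^sup>2) - N * int k" if "k \<le> T" for k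
    using that
  proof (induction k)
    case 0
    then show ?case by (simp add: iterate_def)
  next
    case (Suc k)
    have "(\<Sum>j<n. (iterate (Suc k) j - Z j)\<^sup>2)
        \<le> (\<Sum>j<n. (iterate k j - Z j)\<^sup>2) - 2 * (objective (iterate k) - objective Z) + N"
      using descend_distance[of "iterate k" Z] assms(1-5) by (simp add: iterate_def)
    moreover have "N \<le> objective (iterate k) - objective Z"
      using bad[of k] Z Suc.prems by (simp add: distrib_left)
    ultimately show ?case
      using Suc by (simp add: distrib_left)
  qed
  have "(Z j)\<^sup>2 \<le> N\<^sup>2 * R\<^sup>2" for j
  proof -
    have "(y j)\<^sup>2 \<le> R\<^sup>2"
      using y(2)[of j] by (intro abs_le_square_iff[THEN iffD1]) linarith
    then show ?thesis
      by (simp add: Z_def power_mult_distrib mult_left_mono)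
  qed
  then have "(\<Sum>j<n. (Z j)\<^sup>2) \<le> (\<Sum>j<n. N\<^sup>2 * R\<^sup>2)"
    by (intro sum_mono)
  also have "\<dots> = N * (N * (int n * R\<^sup>2))"
    by (simp add: power2_eq_square)
  also have "\<dots> < N * int T"
    using T \<open>0 < N\<close> by simp
  finally have "(\<Sum>j<n. (iterate T j - Z j)\<^sup>2) < 0"
    using dist[of T] by simp
  then show False
    by (simp add: sum_nonneg leD)
qed

text \<open>The rational point \<open>Y / N\<close> has a value below \<open>K + 1\<close>. Rounding
  does not increase it, and at an integral point the value is an integer, hence at most
  \<open>K\<close>. As \<open>K < M\<close>, no bound is violated there, and the value is the
  norm.\<close>

lemma descent_sound:
  assumes tu: "tu_array m n D" and "0 < N" "0 \<le> K" "K < M"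
    and Y: "objective Y < N * (K + 1)"
  shows "\<exists>y. feasible K y"
proof -
  \<comment> \<open>The extension of \<open>penalty\<close> to the reals, unscaled, to which the
    rounding lemma applies.\<close>
  define g where "g i t = \<bar>t\<bar> + of_int M * max 0 (t - of_int (hi i)) + of_int M * max 0 (of_int (lo i) - t)"
    for i and t :: real
  have aff: "int_affine (g i)" for i
    unfolding g_def by (intro int_affine_add int_affine_abs int_affine_cmult int_affine_max)
  have max_int: "max 0 (of_int a :: real) = of_int (max 0 a)" for a
    by (simp add: max_def)
  have g_int: "g i (of_int t) = of_int (penalty M (lo i) (hi i) t)" for i t
    unfolding g_def penalty_def by (simp add: max_int flip: of_int_diff)
  have g_scaled: "of_int N * g i (of_int (c i) + (\<Sum>j<n. of_int (D i j) * (of_int (Y j) / of_int N)))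
      = of_int (penalty M (N * lo i) (N * hi i) (img N Y i))" for i
  proof -
    define t :: real where "t = of_int (c i) + (\<Sum>j<n. of_int (D i j) * (of_int (Y j) / of_int N))"
    have t: "of_int N * t = of_int (img N Y i)"
      using \<open>0 < N\<close> by (simp add: t_def img_def distrib_left sum_distrib_left)
    have mx: "of_int N * max 0 x = max 0 (of_int N * x)" for x :: real
      using \<open>0 < N\<close> by (simp add: max_mult_distrib_left)
    have ab: "of_int N * \<bar>t\<bar> = \<bar>of_int N * t\<bar>"
      using \<open>0 < N\<close> by (simp add: abs_mult)
    have "of_int N * g i t = of_int N * \<bar>t\<bar> + of_int M * (of_int N * max 0 (t - of_int (hi i)))
        + of_int M * (of_int N * max 0 (of_int (lo i) - t))"
      by (simp add: g_def algebra_simps)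
    also have "\<dots> = of_int (penalty M (N * lo i) (N * hi i) (img N Y i))"
      unfolding ab mx right_diff_distrib t penalty_def
      by (simp add: max_int flip: of_int_diff of_int_mult)
    finally show ?thesis by (simp add: t_def)
  qed
  obtain z :: "nat \<Rightarrow> int" where z: "(\<Sum>i<m. g i (of_int (c i + (\<Sum>j<n. D i j * z j))))
      \<le> (\<Sum>i<m. g i (of_int (c i) + (\<Sum>j<n. of_int (D i j) * (of_int (Y j) / of_int N))))"
    by (rule tu_array_rounding[OF tu, of g c "\<lambda>j. of_int (Y j) / of_int N", OF aff])
  have "of_int N * (\<Sum>i<m. g i (of_int (img 1 z i)))
      \<le> of_int N * (\<Sum>i<m. g i (of_int (c i) + (\<Sum>j<n. of_int (D i j) * (of_int (Y j) / of_int N))))"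
    using z \<open>0 < N\<close> unfolding img_def mult_1 by (intro mult_left_mono) auto
  also have "\<dots> = real_of_int (objective Y)"
    by (simp only: sum_distrib_left g_scaled objective_def of_int_sum)
  finally have "of_int N * (\<Sum>i<m. g i (of_int (img 1 z i))) \<le> real_of_int (objective Y)" .
  then have "real_of_int (N * (\<Sum>i<m. penalty M (lo i) (hi i) (img 1 z i))) \<le> of_int (objective Y)"
    by (simp add: g_int)
  then have "N * (\<Sum>i<m. penalty M (lo i) (hi i) (img 1 z i)) < N * (K + 1)"
    using Y by linarith
  then have pen: "(\<Sum>i<m. penalty M (lo i) (hi i) (img 1 z i)) \<le> K"
    using \<open>0 < N\<close> by simp
  have inside: "lo i \<le> img 1 z i \<and> img 1 z i \<le> hi i" if "i < m" for i
  proof (rule ccontr)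
    assume "\<not> ?thesis"
    then have "M \<le> penalty M (lo i) (hi i) (img 1 z i)"
      using assms by (intro penalty_outside) auto
    also have "\<dots> \<le> (\<Sum>i<m. penalty M (lo i) (hi i) (img 1 z i))"
      using that assms by (intro member_le_sum) (auto intro: penalty_nonneg)
    finally show False
      using pen \<open>K < M\<close> by simp
  qed
  then have "feasible K z"
    using pen by (simp add: feasible_def penalty_inside)
  then show ?thesis by blast
qed

text \<open>By the integer rounding theorem an accuracy below 1 suffices; by Cramer's rule a feasible
  point, if there is one, can be chosen close to the starting point \<open>0\<close>.\<close>

theorem descent_decides:
  assumes tu: "tu_array m n D" and "0 \<le> K" "K < M" "0 < N"
    and c: "\<And>i. i < m \<Longrightarrow> \<bar>c i\<bar> \<le> 1"
    and box: "\<And>i. i < m \<Longrightarrow> - 1 \<le> lo i \<and> lo i \<le> hi i \<and> hi i \<le> 1"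
    and big: "int n * (int m * (M + 1))\<^sup>2 \<le> N"
    and T: "N * (int n * (int m * (int m * 2))\<^sup>2) < int T"
  shows "(\<exists>k<T. objective (iterate k) < N * (K + 1)) \<longleftrightarrow> (\<exists>y. feasible K y)"
proof
  assume "\<exists>k<T. objective (iterate k) < N * (K + 1)"
  then show "\<exists>y. feasible K y"
    using descent_sound[OF tu \<open>0 < N\<close> \<open>0 \<le> K\<close> \<open>K < M\<close>] by blast
next
  assume "\<exists>y. feasible K y"
  then obtain y where y: "feasible K y" ..
  \<comment> \<open>A difference of two chains with entries in [-1, 1]; this is the origin of the 2
    in the radius \<open>m * (m * 2)\<close>.\<close>
  have b: "\<bar>\<Sum>j<n. D i j * y j\<bar> \<le> 2" if "i \<in> {..<m}" for i
    using c[of i] box[of i] y that by (auto simp: feasible_def img_def)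
  have e: "(\<Sum>j<n. real_of_int (D i j) * of_int (y j)) = of_int (\<Sum>j<n. D i j * y j)" for i
    by simp
  \<comment> \<open>The feasible \<open>y\<close> is used as a real solution of its own system and
    exchanged for a small one with the same image.\<close>
  obtain z :: "nat \<Rightarrow> int" where z: "\<And>i. i \<in> {..<m} \<Longrightarrow> (\<Sum>j<n. D i j * z j) = (\<Sum>j<n. D i j * y j)"
    and zb: "\<And>j. \<bar>z j\<bar> \<le> int m * (int m * 2)"
    by (rule tu_array_integer_solution[OF tu order_refl e b]) auto
  have "feasible K z"
    using y z by (simp add: feasible_def img_def)
  moreover have "\<bar>D i j\<bar> \<le> 1" if "i < m" "j < n" for i j
  proof -
    have "det (mat 1 1 (\<lambda>(a, b). D i j)) \<in> {-1, 0, 1}"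
      using tu that unfolding tu_array_def
      by (elim allE[of _ 1] allE[of _ "\<lambda>_. i"] allE[of _ "\<lambda>_. j"]) simp
    moreover have "det (mat 1 1 (\<lambda>(a, b). D i j)) = D i j"
      by (subst det_single) auto
    ultimately show ?thesis by auto
  qed
  ultimately show "\<exists>k<T. objective (iterate k) < N * (K + 1)"
    using descent_complete[OF _ \<open>0 < N\<close> _ _ big _ zb T] assms by auto
qed

end

section \<open>Running time bounds for programs\<close>

lemma set_var_simps [simp]:
  "vars (set_var x v s) = (vars s)(x := v)" "arrays (set_var x v s) = arrays s"
  by (simp_all add: set_var_def)

lemma set_elem_simps [simp]:
  "vars (set_elem a i v s) = vars s"
  "arrays (set_elem a i v s) = (arrays s)(a := (arrays s a)(i := v))"
  by (simp_all add: set_elem_def)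

fun written_vars :: "prog \<Rightarrow> nat set" where
  "written_vars (Assign x e) = {x}"
| "written_vars (Seq c d) = written_vars c \<union> written_vars d"
| "written_vars (If b c d) = written_vars c \<union> written_vars d"
| "written_vars (While b c) = written_vars c"
| "written_vars _ = {}"

fun written_arrays :: "prog \<Rightarrow> nat set" where
  "written_arrays (Store a e f) = {a}"
| "written_arrays (Seq c d) = written_arrays c \<union> written_arrays d"
| "written_arrays (If b c d) = written_arrays c \<union> written_arrays d"
| "written_arrays (While b c) = written_arrays c"
| "written_arrays _ = {}"

definition preserves :: "nat set \<Rightarrow> nat set \<Rightarrow> state \<Rightarrow> state \<Rightarrow> bool" where
  "preserves X A s s' \<longleftrightarrow>
     (\<forall>x. x \<notin> X \<longrightarrow> vars s' x = vars s x) \<and> (\<forall>a. a \<notin> A \<longrightarrow> arrays s' a = arrays s a)"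

lemma preservesD:
  assumes "preserves X A s s'"
  shows "x \<notin> X \<Longrightarrow> vars s' x = vars s x" "a \<notin> A \<Longrightarrow> arrays s' a = arrays s a"
  using assms by (auto simp: preserves_def)

lemma runs_preserves:
  "runs c s t s' \<Longrightarrow> preserves (written_vars c) (written_arrays c) s s'"
  by (induction rule: runs.induct) (auto simp: preserves_def)

text \<open>Total correctness with a time bound, for one initial state. The postcondition may itself
  be an \<open>ends_in\<close> statement, as in a weakest precondition calculus.\<close>

definition ends_in :: "prog \<Rightarrow> state \<Rightarrow> nat \<Rightarrow> (state \<Rightarrow> bool) \<Rightarrow> bool" where
  "ends_in c s B Q \<longleftrightarrow> (\<exists>t s'. runs c s t s' \<and> t \<le> B \<and> Q s')"

text \<open>The rule of consequence combined with the frame rule: the new postcondition may use that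
  all memory not written by \<open>c\<close> is unchanged.\<close>

lemma ends_in_mono:
  assumes "ends_in c s B Q" "B \<le> B'"
    and "\<And>s'. preserves (written_vars c) (written_arrays c) s s' \<Longrightarrow> Q s' \<Longrightarrow> Q' s'"
  shows "ends_in c s B' Q'"
  using assms runs_preserves unfolding ends_in_def by (meson order_trans)

lemma ends_in_Seq:
  assumes "ends_in c s B (\<lambda>s'. ends_in d s' B' Q)" "1 + B + B' \<le> T"
  shows "ends_in (Seq c d) s T Q"
proof -
  obtain t s' u s'' where "runs c s t s'" "t \<le> B" "runs d s' u s''" "u \<le> B'" "Q s''"
    using assms(1) unfolding ends_in_def by blast
  then show ?thesis
    using assms(2) runs.Seq[of c s t s' d u s''] unfolding ends_in_def by fastforce
qed

text \<open>Adding the bounds of both branches instead of taking their maximum keeps running times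
  within sums and products, the operations under which \<open>poly_bounded\<close> is shown to be
  closed.\<close>

lemma ends_in_If:
  assumes "bval b s \<Longrightarrow> ends_in c s B Q" "\<not> bval b s \<Longrightarrow> ends_in d s B' Q"
    and "1 + bcost b + B + B' \<le> T"
  shows "ends_in (If b c d) s T Q"
proof (cases "bval b s")
  case True
  then obtain t s' where "runs c s t s'" "t \<le> B" "Q s'"
    using assms(1) unfolding ends_in_def by blast
  then show ?thesis
    using assms(3) runs.IfTrue[OF True, of c t s' d] unfolding ends_in_def by fastforce
next
  case False
  then obtain t s' where "runs d s t s'" "t \<le> B'" "Q s'"
    using assms(2) unfolding ends_in_def by blast
  then show ?thesis
    using assms(3) runs.IfFalse[OF False, of d t s' c] unfolding ends_in_def by fastforce
qed

text \<open>The invariant is indexed by the number of completed rounds. A true guard must imply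
  \<open>k < r\<close>, which gives termination; the final summands pay for the failing
  test.\<close>

lemma ends_in_While:
  assumes step: "\<And>k s. I k s \<Longrightarrow> bval b s \<Longrightarrow> k < r \<and> ends_in c s B (I (Suc k))"
    and "I 0 s"
  shows "ends_in (While b c) s (r * (1 + bcost b + B) + 1 + bcost b) (\<lambda>s'. \<not> bval b s' \<and> (\<exists>k\<le>r. I k s'))"
proof -
  have "ends_in (While b c) s ((r - k) * (1 + bcost b + B) + 1 + bcost b)
     (\<lambda>s'. \<not> bval b s' \<and> (\<exists>k\<le>r. I k s'))" if "I k s" "k \<le> r" for k
    using that
  proof (induction "r - k" arbitrary: k s)
    case 0
    then have "\<not> bval b s" using step by fastforce
    then have "runs (While b c) s (1 + bcost b) s" by (rule WhileFalse)
    with 0 \<open>\<not> bval b s\<close> show ?case unfolding ends_in_def by fastforce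
  next
    case (Suc d)
    show ?case
    proof (cases "bval b s")
      case True
      then obtain t s' where t: "runs c s t s'" "t \<le> B" "I (Suc k) s'"
        using step[OF Suc.prems(1)] unfolding ends_in_def by blast
      have k: "k < r" "d = r - Suc k"
        using Suc.hyps by auto
      obtain u s'' where u: "runs (While b c) s' u s''" "u \<le> d * (1 + bcost b + B) + 1 + bcost b"
        "\<not> bval b s'' \<and> (\<exists>k\<le>r. I k s'')"
        using Suc.hyps(1)[OF k(2) t(3)] k unfolding ends_in_def by auto
      have "1 + bcost b + t + u \<le> (r - k) * (1 + bcost b + B) + 1 + bcost b"
        using t(2) u(2) unfolding Suc.hyps(2)[symmetric] by simp
      then show ?thesis
        using runs.WhileTrue[OF True t(1) u(1)] u(3) unfolding ends_in_def by blast
    next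
      case False
      then have "runs (While b c) s (1 + bcost b) s" by (rule WhileFalse)
      with Suc.prems False show ?thesis unfolding ends_in_def by fastforce
    qed
  qed
  from this[of 0] \<open>I 0 s\<close> show ?thesis by simp
qed

section \<open>Loop-free programs and counting loops\<close>

fun loop_free :: "prog \<Rightarrow> bool" where
  "loop_free (Seq c d) \<longleftrightarrow> loop_free c \<and> loop_free d"
| "loop_free (If b c d) \<longleftrightarrow> loop_free c \<and> loop_free d"
| "loop_free (While b c) \<longleftrightarrow> False"
| "loop_free _ \<longleftrightarrow> True"

text \<open>The last equation is meant for \<open>Skip\<close>; its value for loops is a default
  that \<open>loop_free\<close> excludes.\<close>

fun exec :: "prog \<Rightarrow> state \<Rightarrow> state" where
  "exec (Assign x e) s = set_var x (aval e s) s"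
| "exec (Store a e f) s = set_elem a (aval e s) (aval f s) s"
| "exec (Seq c d) s = exec d (exec c s)"
| "exec (If b c d) s = (if bval b s then exec c s else exec d s)"
| "exec _ s = s"

fun cost :: "prog \<Rightarrow> nat" where
  "cost (Assign x e) = 1 + acost e"
| "cost (Store a e f) = 1 + acost e + acost f"
| "cost (Seq c d) = 1 + cost c + cost d"
| "cost (If b c d) = 1 + bcost b + cost c + cost d"
| "cost _ = 1"

text \<open>Reduces straight-line code to evaluating \<open>exec\<close> and \<open>cost\<close>,
  which the simplifier can do.\<close>

lemma ends_in_loop_free:
  assumes "loop_free c" "cost c \<le> B" "Q (exec c s)"
  shows "ends_in c s B Q"
proof -
  have "ends_in c s (cost c) (\<lambda>s'. s' = exec c s)"
    using assms(1)
  proof (induction c arbitrary: s)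
    case (Seq c d)
    then have "ends_in c s (cost c) (\<lambda>s'. ends_in d s' (cost d) (\<lambda>s''. s'' = exec d (exec c s)))"
      by (intro ends_in_mono[OF Seq.IH(1)]) auto
    then show ?case
      by (intro ends_in_Seq[of c s "cost c" d "cost d"]) auto
  next
    case (If b c d)
    have "ends_in c s (cost c) (\<lambda>s'. s' = exec (prog.If b c d) s)" if "bval b s"
      using If that by simp
    moreover have "ends_in d s (cost d) (\<lambda>s'. s' = exec (prog.If b c d) s)" if "\<not> bval b s"
      using If that by simp
    ultimately show ?case
      by (rule ends_in_If) auto
  next
    case Skip
    show ?case using runs.Skip[of s] unfolding ends_in_def by force
  next
    case (Assign x e)
    show ?case using runs.Assign[of x e s] unfolding ends_in_def by force
  next
    case (Store a e f)
    show ?case using runs.Store[of a e f s] unfolding ends_in_def by force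
  qed simp
  then show ?thesis
    by (rule ends_in_mono) (use assms in auto)
qed

definition For :: "nat \<Rightarrow> nat \<Rightarrow> prog \<Rightarrow> prog" where
  "For x b c = Seq (Assign x (Const 0))
     (While (Less (Var x) (Var b)) (Seq c (Assign x (Plus (Var x) (Const 1)))))"

lemma written_For [simp]:
  "written_vars (For x b c) = insert x (written_vars c)"
  "written_arrays (For x b c) = written_arrays c"
  by (auto simp: For_def)

text \<open>A round costs 4 for the test, 4 for the increment and 1 for sequencing besides the body.
  The 7 consists of 2 for the initialisation, 1 for sequencing and 4 for the last test.\<close>

definition for_time :: "nat \<Rightarrow> nat \<Rightarrow> nat" where
  "for_time r B = r * (B + 9) + 7"

text \<open>The rule itself keeps track of the counter and of the unwritten memory, so
  \<open>I\<close> describes only what the body changes; \<open>indep\<close> makes \<open>I\<close>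
  survive the updates of the counter.\<close>

lemma ends_in_For:
  assumes b: "vars s b = int r" "b \<notin> written_vars c" "x \<notin> written_vars c" "x \<noteq> b"
    and init: "I 0 s"
    and indep: "\<And>k s v. I k s \<Longrightarrow> I k (set_var x v s)"
    and step: "\<And>k s'. k < r \<Longrightarrow> vars s' x = int k
        \<Longrightarrow> preserves (insert x (written_vars c)) (written_arrays c) s s'
        \<Longrightarrow> I k s' \<Longrightarrow> ends_in c s' B (I (Suc k))"
    and post: "\<And>s'. preserves (insert x (written_vars c)) (written_arrays c) s s' \<Longrightarrow> I r s' \<Longrightarrow> Q s'"
    and T: "for_time r B \<le> T"
  shows "ends_in (For x b c) s T Q"
proof -
  let ?P = "preserves (insert x (written_vars c)) (written_arrays c) s"
  define J where "J k s' \<longleftrightarrow> k \<le> r \<and> vars s' x = int k \<and> ?P s' \<and> I k s'" for k s'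
  let ?b = "Less (Var x) (Var b)" and ?c = "Seq c (Assign x (Plus (Var x) (Const 1)))"
  have vb: "vars s' b = int r" if "?P s'" for s'
    using preservesD(1)[OF that, of b] b by simp
  have body: "k < r \<and> ends_in ?c s' (B + 5) (J (Suc k))" if J: "J k s'" and t: "bval ?b s'" for k s'
  proof
    show "k < r"
      using J t vb[of s'] by (simp add: J_def)
    then have "ends_in c s' B (I (Suc k))"
      using step J by (simp add: J_def)
    then have "ends_in c s' B (\<lambda>s''. ends_in (Assign x (Plus (Var x) (Const 1))) s'' 4 (J (Suc k)))"
    proof (rule ends_in_mono)
      fix s'' assume p: "preserves (written_vars c) (written_arrays c) s' s''" and I: "I (Suc k) s''"
      have "vars s'' x = int k"
        using preservesD(1)[OF p, of x] b J by (simp add: J_def)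
      moreover have "?P s''"
        using p J by (auto simp: J_def preserves_def)
      ultimately have "J (Suc k) (set_var x (int k + 1) s'')"
        using \<open>k < r\<close> indep[OF I] by (auto simp: J_def preserves_def)
      then show "ends_in (Assign x (Plus (Var x) (Const 1))) s'' 4 (J (Suc k))"
        using \<open>vars s'' x = int k\<close> by (intro ends_in_loop_free) simp_all
    qed simp
    then show "ends_in ?c s' (B + 5) (J (Suc k))"
      by (rule ends_in_Seq) simp
  qed
  have J0: "J 0 (set_var x 0 s)"
    using indep[OF init] by (auto simp: J_def preserves_def)
  have "ends_in (While ?b ?c) (set_var x 0 s) (r * (1 + bcost ?b + (B + 5)) + 1 + bcost ?b)
      (\<lambda>s'. \<not> bval ?b s' \<and> (\<exists>k\<le>r. J k s'))"
    by (rule ends_in_While[of J]) (use body J0 in auto)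
  then have "ends_in (While ?b ?c) (set_var x 0 s) (r * (B + 9) + 4) Q"
  proof (rule ends_in_mono)
    fix s' assume "\<not> bval ?b s' \<and> (\<exists>k\<le>r. J k s')"
    then obtain k where k: "k \<le> r" "J k s'" "\<not> bval ?b s'" by blast
    then have "k = r"
      using vb[of s'] by (simp add: J_def)
    with k show "Q s'"
      using post by (simp add: J_def)
  qed (simp add: algebra_simps)
  then have "ends_in (Assign x (Const 0)) s 2 (\<lambda>s'. ends_in (While ?b ?c) s' (r * (B + 9) + 4) Q)"
    by - (rule ends_in_loop_free, simp_all)
  then show ?thesis
    unfolding For_def by (rule ends_in_Seq) (use T in \<open>simp add: for_time_def\<close>)
qed

section \<open>Programs for the decision problem\<close>

text \<open>\<open>vK\<close> is the bound on the norm, \<open>vN\<close> the scaling factor, \<open>vT\<close> the number of descent steps,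
  \<open>vM\<close> the penalty weight; arrays 0 to 2 are prescribed by the input and output convention.\<close>

abbreviation (input) vm :: nat where "vm \<equiv> 0"
abbreviation (input) vn :: nat where "vn \<equiv> 1"
abbreviation (input) vK :: nat where "vK \<equiv> 2"
abbreviation (input) vN :: nat where "vN \<equiv> 3"
abbreviation (input) vT :: nat where "vT \<equiv> 4"
abbreviation (input) vM :: nat where "vM \<equiv> 5"
abbreviation (input) found :: nat where "found \<equiv> 6"
abbreviation (input) vl :: nat where "vl \<equiv> 7"
abbreviation (input) vk :: nat where "vk \<equiv> 8"
abbreviation (input) vi :: nat where "vi \<equiv> 9"
abbreviation (input) vj :: nat where "vj \<equiv> 10"
abbreviation (input) acc :: nat where "acc \<equiv> 11"
abbreviation (input) total :: nat where "total \<equiv> 12"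
abbreviation (input) slp :: nat where "slp \<equiv> 13"

abbreviation (input) aD :: nat where "aD \<equiv> 0"
abbreviation (input) ac :: nat where "ac \<equiv> 1"
abbreviation (input) alo :: nat where "alo \<equiv> 2"
abbreviation (input) ahi :: nat where "ahi \<equiv> 3"
abbreviation (input) aY :: nat where "aY \<equiv> 4"
abbreviation (input) aS :: nat where "aS \<equiv> 5"

abbreviation (input) entry :: aexp where
  "entry \<equiv> Elem aD (Plus (Times (Var vi) (Var vn)) (Var vj))"

definition row_prog :: prog where
  "row_prog = Seq (Assign acc (Times (Var vN) (Elem ac (Var vi))))
     (For vj vn (Assign acc (Plus (Var acc) (Times entry (Elem aY (Var vj))))))"

text \<open>Value and slope depend on the same comparisons and are computed together. Slopes are
  stored because the descent step needs all of them at the old iterate.\<close>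

definition penalty_prog :: prog where
  "penalty_prog =
    Seq (If (Less (Var acc) (Const 0))
          (Seq (Assign slp (Const (-1))) (Assign total (Minus (Var total) (Var acc))))
          (Seq (Assign slp (Const 1)) (Assign total (Plus (Var total) (Var acc)))))
   (Seq (If (Less (Times (Var vN) (Elem ahi (Var vi))) (Var acc))
          (Seq (Assign slp (Plus (Var slp) (Var vM)))
               (Assign total (Plus (Var total)
                 (Times (Var vM) (Minus (Var acc) (Times (Var vN) (Elem ahi (Var vi))))))))
          Skip)
   (Seq (If (Less (Var acc) (Times (Var vN) (Elem alo (Var vi))))
          (Seq (Assign slp (Minus (Var slp) (Var vM)))
               (Assign total (Plus (Var total)
                 (Times (Var vM) (Minus (Times (Var vN) (Elem alo (Var vi))) (Var acc))))))
          Skip)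
     (Store aS (Var vi) (Var slp))))"

definition evaluate_prog :: prog where
  "evaluate_prog = Seq (Assign total (Const 0)) (For vi vm (Seq row_prog penalty_prog))"

text \<open>The iterate can be overwritten in place, since only the stored slopes are read besides
  the coordinate being updated.\<close>

definition descend_prog :: prog where
  "descend_prog = For vj vn (For vi vm
     (Store aY (Var vj) (Minus (Elem aY (Var vj)) (Times entry (Elem aS (Var vi))))))"

text \<open>All \<open>vT\<close> rounds are made and any success is recorded in
  \<open>found\<close>: the subgradient method need not decrease the objective, so the last iterate
  may be worse than an earlier one.\<close>

definition decide_prog :: prog where
  "decide_prog =
    Seq (Assign found (Const 0))
   (Seq (For vj vn (Store aY (Var vj) (Const 0)))
     (For vk vT
       (Seq evaluate_prog
       (Seq (If (Less (Var total) (Times (Var vN) (Plus (Var vK) (Const 1))))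
              (Assign found (Const 1)) Skip)
         descend_prog))))"

lemma written_progs:
  "written_vars row_prog = {acc, vj}" "written_arrays row_prog = {}"
  "written_vars penalty_prog = {slp, total}" "written_arrays penalty_prog = {aS}"
  "written_vars evaluate_prog = {total, vi, acc, vj, slp}" "written_arrays evaluate_prog = {aS}"
  "written_vars descend_prog = {vi, vj}" "written_arrays descend_prog = {aY}"
  "written_vars decide_prog = {found, vk, total, vi, acc, vj, slp}"
  "written_arrays decide_prog = {aY, aS}"
  by (auto simp: row_prog_def penalty_prog_def evaluate_prog_def descend_prog_def decide_prog_def)

text \<open>Numerals in the time bounds are costs of loop-free pieces, such as the 12 for one
  product added to \<open>acc\<close> and, in \<open>descend_time\<close>, the 14 for one update of
  \<open>aY\<close>.\<close>

definition row_time :: "nat \<Rightarrow> nat" where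
  "row_time n = 6 + for_time n 12"

definition evaluate_time :: "nat \<Rightarrow> nat \<Rightarrow> nat" where
  "evaluate_time m n = 3 + for_time m (1 + row_time n + cost penalty_prog)"

definition descend_time :: "nat \<Rightarrow> nat \<Rightarrow> nat" where
  "descend_time m n = for_time n (for_time m 14)"

definition decide_time :: "nat \<Rightarrow> nat \<Rightarrow> nat \<Rightarrow> nat" where
  "decide_time m n T = 4 + for_time n 3 + for_time T (14 + evaluate_time m n + descend_time m n)"

lemma penalty_prog_spec:
  assumes "vars s vM = M" "vars s vN * arrays s alo (vars s vi) = l"
    "vars s vN * arrays s ahi (vars s vi) = h"
  shows "ends_in penalty_prog s (cost penalty_prog) (\<lambda>s'.
    vars s' total = vars s total + penalty M l h (vars s acc) \<and>
    arrays s' aS = (arrays s aS)(vars s vi := slope M l h (vars s acc)))"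
proof (rule ends_in_loop_free)
  show "loop_free penalty_prog" by (simp add: penalty_prog_def)
  show "vars (exec penalty_prog s) total = vars s total + penalty M l h (vars s acc) \<and>
    arrays (exec penalty_prog s) aS = (arrays s aS)(vars s vi := slope M l h (vars s acc))"
    using assms by (auto simp: penalty_prog_def penalty_def slope_def max_def)
qed simp

section \<open>Correctness of the decision program\<close>

context box_problem
begin

text \<open>Collects data that the decision program reads without ever writing, so that
  \<open>ready_preserves\<close> carries it through every intermediate state.\<close>

definition ready :: "state \<Rightarrow> bool" where
  "ready s \<longleftrightarrow> vars s vm = int m \<and> vars s vn = int n \<and> vars s vN = N \<and> vars s vM = M \<and>
     (\<forall>i<m. \<forall>j<n. arrays s aD (int i * int n + int j) = D i j) \<and>
     (\<forall>i<m. arrays s ac (int i) = c i \<and> arrays s alo (int i) = lo i \<and> arrays s ahi (int i) = hi i)"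

lemma ready_preserves:
  assumes "ready s" "preserves X A s s'" "X \<inter> {vm, vn, vN, vM} = {}" "A \<inter> {aD, ac, alo, ahi} = {}"
  shows "ready s'"
proof -
  have "vars s' x = vars s x" if "x \<in> {vm, vn, vN, vM}" for x
    using that assms(3) preservesD(1)[OF assms(2)] by blast
  moreover have "arrays s' a = arrays s a" if "a \<in> {aD, ac, alo, ahi}" for a
    using that assms(4) preservesD(2)[OF assms(2)] by blast
  ultimately show ?thesis
    using assms(1) by (simp add: ready_def)
qed

definition holds :: "(nat \<Rightarrow> int) \<Rightarrow> state \<Rightarrow> bool" where
  "holds Y s \<longleftrightarrow> (\<forall>j<n. arrays s aY (int j) = Y j)"

lemma row_prog_spec:
  assumes s: "ready s" "holds Y s" and i: "vars s vi = int i" "i < m"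
  shows "ends_in row_prog s (row_time n) (\<lambda>s'. vars s' acc = img N Y i)"
  unfolding row_prog_def row_time_def
proof (rule ends_in_Seq)
  let ?body = "Assign acc (Plus (Var acc) (Times entry (Elem aY (Var vj))))"
  let ?s = "set_var acc (N * c i) s"
  have "ends_in (For vj vn ?body) ?s (for_time n 12) (\<lambda>s'. vars s' acc = img N Y i)"
  proof (rule ends_in_For[where B = 12
        and I = "\<lambda>k s'. vars s' acc = N * c i + (\<Sum>j<k. D i j * Y j)"])
    fix k s' assume k: "k < n" "vars s' vj = int k"
      and p: "preserves (insert vj (written_vars ?body)) (written_arrays ?body) ?s s'"
      and I: "vars s' acc = N * c i + (\<Sum>j<k. D i j * Y j)"
    have "vars s' vi = int i" "vars s' vn = int n" "arrays s' = arrays s"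
      using preservesD[OF p] s i by (auto simp: ready_def)
    then show "ends_in ?body s' 12 (\<lambda>s'. vars s' acc = N * c i + (\<Sum>j<Suc k. D i j * Y j))"
      using k I i s by (intro ends_in_loop_free) (auto simp: ready_def holds_def)
  qed (use s in \<open>auto simp: ready_def img_def\<close>)
  then show "ends_in (Assign acc (Times (Var vN) (Elem ac (Var vi)))) s 5
      (\<lambda>s'. ends_in (For vj vn ?body) s' (for_time n 12) (\<lambda>s'. vars s' acc = img N Y i))"
    using s i by - (rule ends_in_loop_free, simp_all add: ready_def)
qed simp

lemma evaluate_prog_spec:
  assumes s: "ready s" "holds Y s"
  shows "ends_in evaluate_prog s (evaluate_time m n)
    (\<lambda>s'. vars s' total = objective Y \<and> (\<forall>i<m. arrays s' aS (int i) = slope_at Y i))"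
  unfolding evaluate_prog_def evaluate_time_def
proof (rule ends_in_Seq)
  let ?body = "Seq row_prog penalty_prog"
  let ?s = "set_var total 0 s"
  let ?Q = "\<lambda>k s'. vars s' total = (\<Sum>i<k. penalty M (N * lo i) (N * hi i) (img N Y i)) \<and>
      (\<forall>i<k. arrays s' aS (int i) = slope_at Y i)"
  have "ends_in (For vi vm ?body) ?s (for_time m (1 + row_time n + cost penalty_prog))
    (\<lambda>s'. vars s' total = objective Y \<and> (\<forall>i<m. arrays s' aS (int i) = slope_at Y i))"
  proof (rule ends_in_For[where B = "1 + row_time n + cost penalty_prog" and I = ?Q])
    fix k s' assume k: "k < m" "vars s' vi = int k" and I: "?Q k s'"
      and p: "preserves (insert vi (written_vars ?body)) (written_arrays ?body) ?s s'"
    have s': "ready s'" "holds Y s'"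
    proof -
      have "ready ?s" using s by (simp add: ready_def)
      then show "ready s'"
        using p by (rule ready_preserves) (auto simp: written_progs)
      show "holds Y s'"
        using s preservesD(2)[OF p, of aY] by (simp add: holds_def written_progs)
    qed
    show "ends_in ?body s' (1 + row_time n + cost penalty_prog) (?Q (Suc k))"
    proof (rule ends_in_Seq)
      show "ends_in row_prog s' (row_time n)
        (\<lambda>s''. ends_in penalty_prog s'' (cost penalty_prog) (?Q (Suc k)))"
      proof (rule ends_in_mono[OF row_prog_spec[OF s' k(2) k(1)]])
        fix s'' assume p': "preserves (written_vars row_prog) (written_arrays row_prog) s' s''"
          and acc: "vars s'' acc = img N Y k"
        have r: "ready s''"
          using s'(1) p' by (rule ready_preserves) (auto simp: written_progs)
        have vi: "vars s'' vi = int k" and tot: "vars s'' total = vars s' total"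
          and aS: "arrays s'' aS = arrays s' aS"
          using preservesD[OF p'] k by (simp_all add: written_progs)
        have "ends_in penalty_prog s'' (cost penalty_prog) (\<lambda>s3.
          vars s3 total = vars s'' total + penalty M (N * lo k) (N * hi k) (vars s'' acc) \<and>
          arrays s3 aS = (arrays s'' aS)(vars s'' vi := slope M (N * lo k) (N * hi k) (vars s'' acc)))"
          using r vi k by (intro penalty_prog_spec) (auto simp: ready_def)
        then show "ends_in penalty_prog s'' (cost penalty_prog) (?Q (Suc k))"
          by (rule ends_in_mono)
            (use I in \<open>auto simp: vi tot aS acc slope_at_def less_Suc_eq\<close>)
      qed simp
    qed simp
  qed (use s in \<open>auto simp: ready_def objective_def written_progs\<close>)
  then show "ends_in (Assign total (Const 0)) s 2 (\<lambda>s'. ends_in (For vi vm ?body) s'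
      (for_time m (1 + row_time n + cost penalty_prog))
      (\<lambda>s'. vars s' total = objective Y \<and> (\<forall>i<m. arrays s' aS (int i) = slope_at Y i)))"
    by - (rule ends_in_loop_free, simp_all)
qed simp

lemma descend_prog_spec:
  assumes s: "ready s" "holds Y s" "\<And>i. i < m \<Longrightarrow> arrays s aS (int i) = slope_at Y i"
  shows "ends_in descend_prog s (descend_time m n) (holds (descend Y))"
  unfolding descend_prog_def descend_time_def
proof -
  let ?upd = "Store aY (Var vj) (Minus (Elem aY (Var vj)) (Times entry (Elem aS (Var vi))))"
  let ?I = "\<lambda>k s'. \<forall>j<n. arrays s' aY (int j) = (if j < k then descend Y j else Y j)"
  let ?J = "\<lambda>k l s'. \<forall>j<n. arrays s' aY (int j) =
      (if j < k then descend Y j else if j = k then Y k - (\<Sum>i<l. D i k * slope_at Y i) else Y j)"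
  show "ends_in (For vj vn (For vi vm ?upd)) s (for_time n (for_time m 14)) (holds (descend Y))"
  proof (rule ends_in_For[where B = "for_time m 14" and I = ?I])
    fix k s' assume k: "k < n" "vars s' vj = int k" and I: "?I k s'"
      and p: "preserves (insert vj (written_vars (For vi vm ?upd))) (written_arrays (For vi vm ?upd)) s s'"
    have r: "ready s'"
      using s(1) p by (rule ready_preserves) auto
    show "ends_in (For vi vm ?upd) s' (for_time m 14) (?I (Suc k))"
    proof (rule ends_in_For[where B = 14 and I = "?J k"])
      fix l s'' assume l: "l < m" "vars s'' vi = int l" and J: "?J k l s''"
        and p': "preserves (insert vi (written_vars ?upd)) (written_arrays ?upd) s' s''"
      have "ready s''"
        using r p' by (rule ready_preserves) auto
      moreover have "vars s'' vj = int k" "arrays s'' aS (int l) = slope_at Y l"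
        using preservesD[OF p'] preservesD[OF p] k l s by auto
      ultimately show "ends_in ?upd s'' 14 (?J k (Suc l))"
        using J k l by (intro ends_in_loop_free) (auto simp: ready_def)
    next
      fix s'' assume "?J k m s''"
      then show "?I (Suc k) s''"
        by (auto simp: less_Suc_eq descend_def)
    qed (use r I in \<open>auto simp: ready_def\<close>)
  qed (use s in \<open>auto simp: ready_def holds_def\<close>)
qed

lemma decide_prog_spec:
  assumes s: "ready s" "vars s vT = int T"
  shows "ends_in decide_prog s (decide_time m n T)
    (\<lambda>s'. vars s' found = (if \<exists>k<T. objective (iterate k) < N * (vars s vK + 1) then 1 else 0))"
    (is "ends_in _ _ _ ?Q")
  unfolding decide_prog_def
proof (rule ends_in_Seq)
  let ?test = "If (Less (Var total) (Times (Var vN) (Plus (Var vK) (Const 1)))) (Assign found (Const 1)) Skip"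
  let ?body = "Seq evaluate_prog (Seq ?test descend_prog)"
  let ?B = "14 + evaluate_time m n + descend_time m n"
  let ?init = "For vj vn (Store aY (Var vj) (Const 0))"
  let ?hit = "\<lambda>k. objective (iterate k) < N * (vars s vK + 1)"
  \<comment> \<open>The test precedes the step: after \<open>k\<close> rounds the iterates before
    \<open>k\<close> have been tested and \<open>aY\<close> already holds iterate
    \<open>k\<close>.\<close>
  let ?I = "\<lambda>k s'. holds (iterate k) s' \<and> vars s' found = (if \<exists>l<k. ?hit l then 1 else 0)"
  let ?s = "set_var found 0 s"
  have "ends_in (Seq ?init (For vk vT ?body)) ?s (1 + for_time n 3 + for_time T ?B) ?Q"
  proof (rule ends_in_Seq)
    show "ends_in ?init ?s (for_time n 3) (\<lambda>s'. ends_in (For vk vT ?body) s' (for_time T ?B) ?Q)"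
    proof (rule ends_in_For[where B = 3 and I = "\<lambda>k s'. \<forall>j<k. arrays s' aY (int j) = 0"])
      fix s1 assume p1: "preserves (insert vj (written_vars (Store aY (Var vj) (Const 0))))
          (written_arrays (Store aY (Var vj) (Const 0))) ?s s1"
        and z: "\<forall>j<n. arrays s1 aY (int j) = 0"
      have r1: "ready s1"
      proof (rule ready_preserves[OF _ p1])
        show "ready ?s" using s by (simp add: ready_def)
      qed auto
      have s1: "vars s1 found = 0" "vars s1 vT = int T" "vars s1 vK = vars s vK"
        using preservesD[OF p1] s by auto
      show "ends_in (For vk vT ?body) s1 (for_time T ?B) ?Q"
      proof (rule ends_in_For[where B = ?B and I = ?I])
        fix k s2 assume I: "?I k s2"
          and p2: "preserves (insert vk (written_vars ?body)) (written_arrays ?body) s1 s2"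
        have r2: "ready s2"
          using r1 p2 by (rule ready_preserves) (auto simp: written_progs)
        have K2: "vars s2 vK = vars s vK"
          using preservesD[OF p2] s1 by (simp add: written_progs)
        show "ends_in ?body s2 ?B (?I (Suc k))"
        proof (rule ends_in_Seq)
          show "ends_in evaluate_prog s2 (evaluate_time m n)
              (\<lambda>s3. ends_in (Seq ?test descend_prog) s3 (12 + descend_time m n) (?I (Suc k)))"
          proof (rule ends_in_mono[OF evaluate_prog_spec[OF r2]])
            show "holds (iterate k) s2" using I by blast
            fix s3 assume p3: "preserves (written_vars evaluate_prog) (written_arrays evaluate_prog) s2 s3"
              and e: "vars s3 total = objective (iterate k) \<and>
                (\<forall>i<m. arrays s3 aS (int i) = slope_at (iterate k) i)"
            have r3: "ready s3"
              using r2 p3 by (rule ready_preserves) (auto simp: written_progs)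
            have s3: "vars s3 vK = vars s vK" "vars s3 found = vars s2 found" "holds (iterate k) s3"
              using preservesD[OF p3] K2 I by (simp_all add: written_progs holds_def)
            show "ends_in (Seq ?test descend_prog) s3 (12 + descend_time m n) (?I (Suc k))"
            proof (rule ends_in_Seq)
              have "ends_in ?test s3 11 (\<lambda>s4. vars s4 found = (if ?hit k then 1 else vars s3 found))"
                using r3 s3 e by (intro ends_in_loop_free) (auto simp: ready_def)
              then show "ends_in ?test s3 11 (\<lambda>s4. ends_in descend_prog s4 (descend_time m n) (?I (Suc k)))"
              proof (rule ends_in_mono)
                fix s4 assume p4: "preserves (written_vars ?test) (written_arrays ?test) s3 s4"
                  and f: "vars s4 found = (if ?hit k then 1 else vars s3 found)"
                have r4: "ready s4"
                  using r3 p4 by (rule ready_preserves) auto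
                have s4: "holds (iterate k) s4" "\<And>i. i < m \<Longrightarrow> arrays s4 aS (int i) = slope_at (iterate k) i"
                  using preservesD[OF p4] s3 e by (simp_all add: holds_def)
                show "ends_in descend_prog s4 (descend_time m n) (?I (Suc k))"
                proof (rule ends_in_mono[OF descend_prog_spec[OF r4 s4]])
                  fix s5 assume p5: "preserves (written_vars descend_prog) (written_arrays descend_prog) s4 s5"
                    and h: "holds (descend (iterate k)) s5"
                  have "vars s5 found = vars s4 found"
                    using preservesD(1)[OF p5] by (simp add: written_progs)
                  then show "?I (Suc k) s5"
                    using h f s3 I by (auto simp: iterate_def less_Suc_eq)
                qed auto
              qed simp
            qed simp
          qed simp
        qed simp
      next
        show "?I 0 s1" using z s1 by (simp add: holds_def iterate_def)
      qed (use s1 in \<open>auto simp: written_progs holds_def\<close>)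
    next
      fix k s' assume "vars s' vj = int k" "\<forall>j<k. arrays s' aY (int j) = 0"
      then show "ends_in (Store aY (Var vj) (Const 0)) s' 3 (\<lambda>s'. \<forall>j<Suc k. arrays s' aY (int j) = 0)"
        by (intro ends_in_loop_free) (auto simp: less_Suc_eq)
    qed (use s in \<open>auto simp: ready_def\<close>)
  qed simp
  then show "ends_in (Assign found (Const 0)) s 2
      (\<lambda>s'. ends_in (Seq ?init (For vk vT ?body)) s' (1 + for_time n 3 + for_time T ?B) ?Q)"
    by - (rule ends_in_loop_free, simp_all)
qed (simp add: decide_time_def)

end

section \<open>The optimisation program\<close>

text \<open>The \<open>let\<close> belongs to the logic: the expression \<open>r\<close> is
  duplicated in the program text to form a square, at constant cost.\<close>

definition parameters_prog :: prog where
  "parameters_prog =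
    Seq (Assign vM (Plus (Var vm) (Const 1)))
   (Seq (Assign vN (let r = Times (Var vm) (Plus (Var vM) (Const 1))
                    in Plus (Times (Var vn) (Times r r)) (Const 1)))
     (Assign vT (let r = Times (Var vm) (Times (Var vm) (Const 2))
                 in Plus (Times (Var vN) (Times (Var vn) (Times r r))) (Const 1))))"

definition setup_prog :: prog where
  "setup_prog = Seq parameters_prog
     (For vi vm (Seq (Store alo (Var vi) (Const (-1))) (Store ahi (Var vi) (Const 1))))"

text \<open>One linear search for two purposes: \<open>c\<close> raises either the norm bound or the
  value of a single coefficient.\<close>

definition search_prog :: "prog \<Rightarrow> prog" where
  "search_prog c = Seq decide_prog (While (Less (Var found) (Const 1)) (Seq c decide_prog))"

text \<open>First the least possible norm \<open>vK\<close> is found; then the coefficients are fixed one after the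
  other, each at the least value that still admits a chain of this norm. In the end both bounds
  coincide with the chain, so that the array of lower bounds serves as the output.\<close>

definition main_prog :: prog where
  "main_prog =
    Seq setup_prog
   (Seq (search_prog (Assign vK (Plus (Var vK) (Const 1))))
     (For vl vm
       (Seq (Seq (Store alo (Var vl) (Const (-1))) (Store ahi (Var vl) (Const (-1))))
         (search_prog (Seq (Store alo (Var vl) (Plus (Elem alo (Var vl)) (Const 1)))
                           (Store ahi (Var vl) (Plus (Elem ahi (Var vl)) (Const 1))))))))"

definition search_time :: "nat \<Rightarrow> nat \<Rightarrow> nat \<Rightarrow> nat" where
  "search_time r B B' = 5 + B + r * (5 + B' + B)"

text \<open>Besides success the search yields failure of all earlier candidates, from which
  minimality of the norm follows. The witness \<open>w\<close> guarantees that it stops within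
  \<open>r\<close> increments.\<close>

lemma search_prog_spec:
  assumes I: "I 0 s" and w: "w \<le> r" "ok w"
    and decide: "\<And>k s. I k s \<Longrightarrow> k \<le> r \<Longrightarrow> ends_in decide_prog s B
        (\<lambda>s'. I k s' \<and> vars s' found = (if ok k then 1 else 0))"
    and step: "\<And>k s. I k s \<Longrightarrow> k < r \<Longrightarrow> ends_in c s B' (I (Suc k))"
  shows "ends_in (search_prog c) s (search_time r B B') (\<lambda>s'. \<exists>k\<le>r. I k s' \<and> ok k \<and> (\<forall>l<k. \<not> ok l))"
    (is "ends_in _ _ _ ?Q")
  unfolding search_prog_def
proof (rule ends_in_Seq)
  let ?b = "Less (Var found) (Const 1)" and ?c = "Seq c decide_prog"
  define J where "J k s \<longleftrightarrow> k \<le> r \<and> I k s \<and> vars s found = (if ok k then 1 else 0) \<and> (\<forall>l<k. \<not> ok l)"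
    for k s
  have body: "k < r \<and> ends_in ?c s (1 + B' + B) (J (Suc k))" if J: "J k s" and b: "bval ?b s" for k s
  proof
    have "\<not> ok k"
      using J b by (auto simp: J_def)
    \<comment> \<open>No candidate up to \<open>k\<close> is acceptable, so the witness
      \<open>w\<close> still lies ahead.\<close>
    then show k: "k < r"
      using J w by (metis J_def le_neq_implies_less nat_neq_iff order_le_less_trans)
    have "ends_in c s B' (I (Suc k))"
      using J k by (intro step) (auto simp: J_def)
    then have "ends_in c s B' (\<lambda>s'. ends_in decide_prog s' B (J (Suc k)))"
    proof (rule ends_in_mono)
      fix s' assume "I (Suc k) s'"
      then have "ends_in decide_prog s' B
          (\<lambda>s'. I (Suc k) s' \<and> vars s' found = (if ok (Suc k) then 1 else 0))"
        using k by (intro decide) auto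
      then show "ends_in decide_prog s' B (J (Suc k))"
        by (rule ends_in_mono) (use J k \<open>\<not> ok k\<close> in \<open>auto simp: J_def less_Suc_eq\<close>)
    qed simp
    then show "ends_in ?c s (1 + B' + B) (J (Suc k))"
      by (rule ends_in_Seq) simp
  qed
  have "ends_in decide_prog s B (\<lambda>s'. I 0 s' \<and> vars s' found = (if ok 0 then 1 else 0))"
    using I by (rule decide) simp
  then show "ends_in decide_prog s B
      (\<lambda>s'. ends_in (While ?b ?c) s' (r * (1 + bcost ?b + (1 + B' + B)) + 1 + bcost ?b) ?Q)"
  proof (rule ends_in_mono)
    fix s' assume "I 0 s' \<and> vars s' found = (if ok 0 then 1 else 0)"
    then have "J 0 s'" by (simp add: J_def)
    with body have "ends_in (While ?b ?c) s' (r * (1 + bcost ?b + (1 + B' + B)) + 1 + bcost ?b)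
        (\<lambda>s'. \<not> bval ?b s' \<and> (\<exists>k\<le>r. J k s'))"
      by (rule ends_in_While)
    then show "ends_in (While ?b ?c) s' (r * (1 + bcost ?b + (1 + B' + B)) + 1 + bcost ?b) ?Q"
    proof (rule ends_in_mono)
      fix s'' assume "\<not> bval ?b s'' \<and> (\<exists>k\<le>r. J k s'')"
      then show "?Q s''"
        by (auto simp: J_def split: if_splits)
    qed simp
  qed simp
qed (simp add: search_time_def algebra_simps)

text \<open>\<open>m * (m + 2)\<close> is \<open>m * (M + 1)\<close> for \<open>M = m + 1\<close>,
  the bound on an entry of the subgradient. The added 1 keeps the denominator positive when
  \<open>m\<close> or \<open>n\<close> is 0.\<close>

definition scale :: "nat \<Rightarrow> nat \<Rightarrow> nat" where
  "scale m n = n * (m * (m + 2))\<^sup>2 + 1"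

text \<open>\<open>m * (m * 2)\<close> is the Cramer bound on the entries of a feasible point, so
  its square times \<open>n\<close> bounds the squared distance from the starting point; the added 1
  makes the inequality strict.\<close>

definition rounds :: "nat \<Rightarrow> nat \<Rightarrow> nat" where
  "rounds m n = scale m n * (n * (m * (m * 2))\<^sup>2) + 1"

text \<open>The norm bound is raised at most \<open>m\<close> times, as the given chain has norm at
  most \<open>m\<close>; a coefficient is raised at most twice, from -1 to 1.\<close>

definition main_time :: "nat \<Rightarrow> nat \<Rightarrow> nat" where
  "main_time m n = 60 + for_time m 7 + search_time m (decide_time m n (rounds m n)) 4 +
     for_time m (8 + search_time 2 (decide_time m n (rounds m n)) 15)"

section \<open>Correctness of the optimisation program\<close>

locale chain_problem =
  fixes m n :: nat and D :: "nat \<Rightarrow> nat \<Rightarrow> int" and c :: "nat \<Rightarrow> int"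
  assumes tu: "tu_array m n D" and c: "\<And>i. i < m \<Longrightarrow> \<bar>c i\<bar> \<le> 1"
begin

definition chain :: "(nat \<Rightarrow> int) \<Rightarrow> nat \<Rightarrow> int" where
  "chain y i = c i + (\<Sum>j<n. D i j * y j)"

definition in_box :: "(nat \<Rightarrow> int) \<Rightarrow> (nat \<Rightarrow> int) \<Rightarrow> int \<Rightarrow> bool" where
  "in_box lo hi K \<longleftrightarrow>
     (\<exists>y. (\<forall>i<m. lo i \<le> chain y i \<and> chain y i \<le> hi i) \<and> (\<Sum>i<m. \<bar>chain y i\<bar>) \<le> K)"

definition loaded :: "int \<Rightarrow> (nat \<Rightarrow> int) \<Rightarrow> (nat \<Rightarrow> int) \<Rightarrow> state \<Rightarrow> bool" where
  "loaded K lo hi s \<longleftrightarrow> box_problem.ready m n D c lo hi (int m + 1) (int (scale m n)) s \<and>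
     vars s vT = int (rounds m n) \<and> vars s vK = K"

definition proper :: "(nat \<Rightarrow> int) \<Rightarrow> (nat \<Rightarrow> int) \<Rightarrow> bool" where
  "proper lo hi \<longleftrightarrow> (\<forall>i<m. - 1 \<le> lo i \<and> lo i \<le> hi i \<and> hi i \<le> 1)"

text \<open>Here the constants meet the conditions of \<open>descent_decides\<close>: the weight
  \<open>m + 1\<close> exceeds \<open>K\<close>, while \<open>scale\<close> and
  \<open>rounds\<close> are made for its two size conditions.\<close>

lemma decide_prog_loaded:
  assumes s: "loaded K lo hi s" and K: "0 \<le> K" "K \<le> int m" and lh: "proper lo hi"
  shows "ends_in decide_prog s (decide_time m n (rounds m n))
    (\<lambda>s'. loaded K lo hi s' \<and> vars s' vl = vars s vl \<and>
      vars s' found = (if in_box lo hi K then 1 else 0))"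
proof -
  interpret box_problem m n D c lo hi "int m + 1" "int (scale m n)" .
  have box: "(\<exists>y. feasible K y) \<longleftrightarrow> in_box lo hi K"
    by (simp add: in_box_def feasible_def img_def chain_def)
  have *: "(\<exists>k<rounds m n. objective (iterate k) < int (scale m n) * (K + 1)) \<longleftrightarrow> in_box lo hi K"
    unfolding box[symmetric]
  proof (rule descent_decides)
    show "int n * (int m * (int m + 1 + 1))\<^sup>2 \<le> int (scale m n)"
      by (simp add: scale_def algebra_simps)
    show "int (scale m n) * (int n * (int m * (int m * 2))\<^sup>2) < int (rounds m n)"
      by (simp add: rounds_def)
    have "0 < scale m n" by (simp add: scale_def)
    then show "0 < int (scale m n)" by (simp only: of_nat_0_less_iff)
  qed (use tu c K lh in \<open>auto simp: proper_def\<close>)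
  have "ends_in decide_prog s (decide_time m n (rounds m n))
      (\<lambda>s'. vars s' found = (if in_box lo hi K then 1 else 0))"
    using decide_prog_spec[of s "rounds m n"] s by (simp add: loaded_def *)
  then show ?thesis
  proof (rule ends_in_mono)
    fix s' assume p: "preserves (written_vars decide_prog) (written_arrays decide_prog) s s'"
      and f: "vars s' found = (if in_box lo hi K then 1 else 0)"
    have "ready s'"
      using s by (intro ready_preserves[OF _ p]) (auto simp: loaded_def written_progs)
    then show "loaded K lo hi s' \<and> vars s' vl = vars s vl \<and>
      vars s' found = (if in_box lo hi K then 1 else 0)"
      using f s preservesD(1)[OF p] by (simp add: loaded_def written_progs)
  qed simp
qed

lemma setup_prog_spec:
  assumes s: "vars s vm = int m" "vars s vn = int n" "vars s vK = 0"
    "\<And>i j. i < m \<Longrightarrow> j < n \<Longrightarrow> arrays s aD (int i * int n + int j) = D i j"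
    "\<And>i. i < m \<Longrightarrow> arrays s ac (int i) = c i"
  shows "ends_in setup_prog s (50 + for_time m 7) (loaded 0 (\<lambda>_. -1) (\<lambda>_. 1))"
proof -
  interpret box_problem m n D c "\<lambda>_. -1" "\<lambda>_. 1" "int m + 1" "int (scale m n)" .
  let ?body = "Seq (Store alo (Var vi) (Const (-1))) (Store ahi (Var vi) (Const 1))"
  let ?L = "loaded 0 (\<lambda>_. -1) (\<lambda>_. 1)"
  let ?C = "\<lambda>s1. vars s1 vm = int m \<and> vars s1 vn = int n \<and> vars s1 vK = 0 \<and>
    vars s1 vM = int m + 1 \<and> vars s1 vN = int (scale m n) \<and> vars s1 vT = int (rounds m n) \<and>
    arrays s1 = arrays s"
  have loop: "ends_in (For vi vm ?body) s1 (for_time m 7) ?L" if s1: "?C s1" for s1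
  proof (rule ends_in_For[where B = 7
        and I = "\<lambda>k s'. \<forall>i<k. arrays s' alo (int i) = -1 \<and> arrays s' ahi (int i) = 1"])
    fix k s' assume "vars s' vi = int k" "\<forall>i<k. arrays s' alo (int i) = -1 \<and> arrays s' ahi (int i) = 1"
    then show "ends_in ?body s' 7 (\<lambda>s'. \<forall>i<Suc k. arrays s' alo (int i) = -1 \<and> arrays s' ahi (int i) = 1)"
      by (intro ends_in_loop_free) (auto simp: less_Suc_eq)
  next
    fix s' assume p: "preserves (insert vi (written_vars ?body)) (written_arrays ?body) s1 s'"
      and I: "\<forall>i<m. arrays s' alo (int i) = -1 \<and> arrays s' ahi (int i) = 1"
    then show "?L s'"
      using preservesD[OF p] s1 s by (simp add: loaded_def ready_def)
  qed (use s1 in auto)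
  have "ends_in parameters_prog s 49 (\<lambda>s1. ends_in (For vi vm ?body) s1 (for_time m 7) ?L)"
  proof (rule ends_in_loop_free)
    show "loop_free parameters_prog" "cost parameters_prog \<le> 49"
      by (simp_all add: parameters_prog_def Let_def)
    have "vars s (Suc 0) = int n" using s by simp
    then show "ends_in (For vi vm ?body) (exec parameters_prog s) (for_time m 7) ?L"
      by (intro loop)
        (simp add: s parameters_prog_def Let_def scale_def rounds_def power2_eq_square algebra_simps)
  qed
  then show ?thesis
    unfolding setup_prog_def by (rule ends_in_Seq) simp
qed

lemma main_prog_spec:
  assumes s: "vars s vm = int m" "vars s vn = int n" "vars s vK = 0"
    "\<And>i j. i < m \<Longrightarrow> j < n \<Longrightarrow> arrays s aD (int i * int n + int j) = D i j"
    "\<And>i. i < m \<Longrightarrow> arrays s ac (int i) = c i"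
  shows "ends_in main_prog s (main_time m n) (\<lambda>s'. \<exists>y.
    (\<forall>i<m. arrays s' alo (int i) = chain y i \<and> \<bar>chain y i\<bar> \<le> 1) \<and>
    (\<forall>y'. (\<forall>i<m. \<bar>chain y' i\<bar> \<le> 1) \<longrightarrow> (\<Sum>i<m. \<bar>chain y i\<bar>) \<le> (\<Sum>i<m. \<bar>chain y' i\<bar>)))"
    (is "ends_in _ _ _ ?Q")
proof -
  let ?T = "decide_time m n (rounds m n)"
  let ?lo = "\<lambda>_ :: nat. - 1 :: int" and ?hi = "\<lambda>_ :: nat. 1 :: int"
  let ?inc = "Assign vK (Plus (Var vK) (Const 1))"
  let ?init = "Seq (Store alo (Var vl) (Const (-1))) (Store ahi (Var vl) (Const (-1)))"
  let ?inc' = "Seq (Store alo (Var vl) (Plus (Elem alo (Var vl)) (Const 1)))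
                   (Store ahi (Var vl) (Plus (Elem ahi (Var vl)) (Const 1)))"
  let ?body = "Seq ?init (search_prog ?inc')"
  let ?opt = "\<lambda>K s'. loaded (int K) ?lo ?hi s' \<and> in_box ?lo ?hi (int K) \<and> (\<forall>l<K. \<not> in_box ?lo ?hi (int l))"
  have min_norm: "ends_in (search_prog ?inc) s1 (search_time m ?T 4) (\<lambda>s'. \<exists>K\<le>m. ?opt K s')"
    if s1: "loaded 0 ?lo ?hi s1" for s1
  proof (rule search_prog_spec[where I = "\<lambda>k. loaded (int k) ?lo ?hi" and w = m])
    \<comment> \<open>The given chain, that is \<open>y = 0\<close>, is the witness that ends the
      search for the norm.\<close>
    show "in_box ?lo ?hi (int m)"
      unfolding in_box_def
    proof (intro exI[of _ "\<lambda>_. 0"] conjI allI impI)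
      fix i assume "i < m"
      then show "-1 \<le> chain (\<lambda>_. 0) i" "chain (\<lambda>_. 0) i \<le> 1"
        using c[of i] by (auto simp: chain_def)
    next
      have "(\<Sum>i<m. \<bar>c i\<bar>) \<le> (\<Sum>i<m. 1)"
        using c by (intro sum_mono) auto
      then show "(\<Sum>i<m. \<bar>chain (\<lambda>_. 0) i\<bar>) \<le> int m"
        by (simp add: chain_def)
    qed
  next
    fix k s' assume "loaded (int k) ?lo ?hi s'" "k \<le> m"
    then have "ends_in decide_prog s' ?T (\<lambda>s''. loaded (int k) ?lo ?hi s'' \<and> vars s'' vl = vars s' vl \<and>
      vars s'' found = (if in_box ?lo ?hi (int k) then 1 else 0))"
      by (intro decide_prog_loaded) (auto simp: proper_def)
    then show "ends_in decide_prog s' ?T (\<lambda>s''. loaded (int k) ?lo ?hi s'' \<and>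
      vars s'' found = (if in_box ?lo ?hi (int k) then 1 else 0))"
      by (rule ends_in_mono) auto
  next
    fix k s' assume "loaded (int k) ?lo ?hi s'"
    then show "ends_in ?inc s' 4 (loaded (int (Suc k)) ?lo ?hi)"
      by (intro ends_in_loop_free) (auto simp: loaded_def box_problem.ready_def)
  qed (use s1 in auto)
  have fix_all: "ends_in (For vl vm ?body) s2 (for_time m (8 + search_time 2 ?T 15)) ?Q"
    if "K \<le> m" and s2: "?opt K s2" for K s2
  proof -
    \<comment> \<open>The bounds are existentially quantified because they depend on the outcomes of
      the earlier searches. The surviving chain in the box is what lets the next search
      succeed.\<close>
    define F where "F l s' \<longleftrightarrow> (\<exists>lo hi. loaded (int K) lo hi s' \<and> in_box lo hi (int K) \<and> proper lo hi \<and>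
      (\<forall>i<l. lo i = hi i) \<and> (\<forall>i. l \<le> i \<longrightarrow> lo i = -1 \<and> hi i = 1))" for l :: nat and s'
    show ?thesis
    proof (rule ends_in_For[where I = F])
      show "vars s2 vm = int m"
        using s2 by (auto simp: loaded_def box_problem.ready_def)
      show "F 0 s2"
        using s2 unfolding F_def by (intro exI[of _ ?lo] exI[of _ ?hi]) (auto simp: proper_def)
      show "F k (set_var vl v s')" if "F k s'" for k s' v
        using that by (auto simp: F_def loaded_def box_problem.ready_def)
    next
      fix l s3 assume l: "l < m" "vars s3 vl = int l" and "F l s3"
      then obtain lo hi where s3: "loaded (int K) lo hi s3" and box: "in_box lo hi (int K)"
        and lh: "proper lo hi" "\<forall>i<l. lo i = hi i" "\<forall>i. l \<le> i \<longrightarrow> lo i = -1 \<and> hi i = 1"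
        unfolding F_def by blast
      \<comment> \<open>The shift by 1 makes the candidates 0, 1, 2 stand for the values -1, 0,
        1.\<close>
      let ?lo' = "\<lambda>k :: nat. lo(l := int k - 1)" and ?hi' = "\<lambda>k :: nat. hi(l := int k - 1)"
      let ?I = "\<lambda>k s'. loaded (int K) (?lo' k) (?hi' k) s' \<and> vars s' vl = int l"
      show "ends_in ?body s3 (8 + search_time 2 ?T 15) (F (Suc l))"
      proof (rule ends_in_Seq)
        have "ends_in ?init s3 7 (?I 0)"
          using s3 l by (intro ends_in_loop_free) (auto simp: loaded_def box_problem.ready_def)
        then show "ends_in ?init s3 7 (\<lambda>s4. ends_in (search_prog ?inc') s4 (search_time 2 ?T 15) (F (Suc l)))"
        proof (rule ends_in_mono)
          fix s4 assume s4: "?I 0 s4"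
          \<comment> \<open>The search for coefficient \<open>l\<close> succeeds at the value taken
            by this chain, if not before.\<close>
          obtain y where y: "\<forall>i<m. lo i \<le> chain y i \<and> chain y i \<le> hi i" "(\<Sum>i<m. \<bar>chain y i\<bar>) \<le> int K"
            using box unfolding in_box_def by blast
          have yl: "-1 \<le> chain y l" "chain y l \<le> 1"
            using y(1) lh l by (auto simp: proper_def dest!: spec[of _ l])
          have "ends_in (search_prog ?inc') s4 (search_time 2 ?T 15)
            (\<lambda>s'. \<exists>k\<le>2. ?I k s' \<and> in_box (?lo' k) (?hi' k) (int K) \<and>
               (\<forall>l<k. \<not> in_box (?lo' l) (?hi' l) (int K)))"
          proof (rule search_prog_spec[where I = ?I and w = "nat (chain y l + 1)"])
            show "nat (chain y l + 1) \<le> 2" using yl by simp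
            show "in_box (?lo' (nat (chain y l + 1))) (?hi' (nat (chain y l + 1))) (int K)"
              unfolding in_box_def using y yl by (intro exI[of _ y]) auto
          next
            fix k s' assume I: "?I k s'" and "k \<le> 2"
            then have "ends_in decide_prog s' ?T (\<lambda>s''. loaded (int K) (?lo' k) (?hi' k) s'' \<and>
                vars s'' vl = vars s' vl \<and>
                vars s'' found = (if in_box (?lo' k) (?hi' k) (int K) then 1 else 0))"
              using \<open>K \<le> m\<close> lh by (intro decide_prog_loaded) (auto simp: proper_def)
            then show "ends_in decide_prog s' ?T (\<lambda>s''. ?I k s'' \<and>
                vars s'' found = (if in_box (?lo' k) (?hi' k) (int K) then 1 else 0))"
              by (rule ends_in_mono) (use I in auto)
          next
            fix k s' assume "?I k s'"
            then show "ends_in ?inc' s' 15 (?I (Suc k))"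
              using l by (intro ends_in_loop_free) (auto simp: loaded_def box_problem.ready_def)
          qed (use s4 in auto)
          then show "ends_in (search_prog ?inc') s4 (search_time 2 ?T 15) (F (Suc l))"
          proof (rule ends_in_mono)
            fix s' assume "\<exists>k\<le>2. ?I k s' \<and> in_box (?lo' k) (?hi' k) (int K) \<and>
               (\<forall>l<k. \<not> in_box (?lo' l) (?hi' l) (int K))"
            then obtain k :: nat where "k \<le> 2" "?I k s'" "in_box (?lo' k) (?hi' k) (int K)" by blast
            then show "F (Suc l) s'"
              unfolding F_def using lh
              by (intro exI[of _ "?lo' k"] exI[of _ "?hi' k"]) (auto simp: proper_def less_Suc_eq)
          qed simp
        qed simp
      qed simp
    next
      fix s' assume "F m s'"
      then obtain lo hi where s': "loaded (int K) lo hi s'" "in_box lo hi (int K)" "proper lo hi"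
        "\<forall>i<m. lo i = hi i"
        unfolding F_def by blast
      then obtain y where y: "\<forall>i<m. lo i \<le> chain y i \<and> chain y i \<le> hi i" "(\<Sum>i<m. \<bar>chain y i\<bar>) \<le> int K"
        unfolding in_box_def by blast
      have "arrays s' alo (int i) = chain y i \<and> \<bar>chain y i\<bar> \<le> 1" if "i < m" for i
      proof -
        have "arrays s' alo (int i) = lo i"
          using s'(1) that by (simp add: loaded_def box_problem.ready_def)
        moreover have "-1 \<le> lo i" "hi i \<le> 1" "lo i = hi i"
          using s' that by (auto simp: proper_def)
        moreover have "lo i \<le> chain y i" "chain y i \<le> hi i"
          using y that by auto
        ultimately show ?thesis by auto
      qed
      \<comment> \<open>A chain of smaller norm would have ended the search for the norm
        earlier.\<close>
      moreover have "(\<Sum>i<m. \<bar>chain y i\<bar>) \<le> (\<Sum>i<m. \<bar>chain y' i\<bar>)" if y': "\<forall>i<m. \<bar>chain y' i\<bar> \<le> 1" for y'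
      proof -
        let ?K = "\<Sum>i<m. \<bar>chain y' i\<bar>"
        have "0 \<le> ?K" by (simp add: sum_nonneg)
        then have "in_box ?lo ?hi (int (nat ?K))"
          unfolding in_box_def using y' by (intro exI[of _ y']) (auto simp: abs_le_iff)
        then have "K \<le> nat ?K"
          using s2 by (meson linorder_not_less)
        then show ?thesis
          using y(2) \<open>0 \<le> ?K\<close> by linarith
      qed
      ultimately show "?Q s'" by blast
    qed (auto simp: search_prog_def written_progs)
  qed
  show ?thesis
    unfolding main_prog_def
  proof (rule ends_in_Seq)
    show "ends_in setup_prog s (50 + for_time m 7) (\<lambda>s1. ends_in (Seq (search_prog ?inc) (For vl vm ?body)) s1
       (1 + search_time m ?T 4 + for_time m (8 + search_time 2 ?T 15)) ?Q)"
    proof (rule ends_in_mono[OF setup_prog_spec[OF s]])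
      fix s1 assume "loaded 0 ?lo ?hi s1"
      from min_norm[OF this] have "ends_in (search_prog ?inc) s1 (search_time m ?T 4)
          (\<lambda>s2. ends_in (For vl vm ?body) s2 (for_time m (8 + search_time 2 ?T 15)) ?Q)"
        by (rule ends_in_mono) (use fix_all in auto)
      then show "ends_in (Seq (search_prog ?inc) (For vl vm ?body)) s1
       (1 + search_time m ?T 4 + for_time m (8 + search_time 2 ?T 15)) ?Q"
        by (rule ends_in_Seq) simp
    qed auto
  qed (simp add: main_time_def)
qed

end

section \<open>Polynomial bounds on the running time\<close>

text \<open>Both arguments are bounded by one \<open>x\<close>, which later becomes the number of
  simplices. Natural coefficients keep all values nonnegative, so that bounds can be added and
  multiplied.\<close>

definition poly_bounded :: "(nat \<Rightarrow> nat \<Rightarrow> nat) \<Rightarrow> bool" where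
  "poly_bounded f \<longleftrightarrow> (\<exists>q :: nat poly. \<forall>m n x. m \<le> x \<longrightarrow> n \<le> x \<longrightarrow> f m n \<le> poly q x)"

lemma poly_bounded_const: "poly_bounded (\<lambda>_ _. k)"
  unfolding poly_bounded_def by (rule exI[of _ "[:k:]"]) simp

lemma poly_bounded_args: "poly_bounded (\<lambda>m n. m)" "poly_bounded (\<lambda>m n. n)"
  unfolding poly_bounded_def by (rule exI[of _ "[:0, 1:]"], simp)+

lemma poly_bounded_add:
  assumes "poly_bounded f" "poly_bounded g"
  shows "poly_bounded (\<lambda>m n. f m n + g m n)"
proof -
  obtain p q where "\<forall>m n x. m \<le> x \<longrightarrow> n \<le> x \<longrightarrow> f m n \<le> poly p x"
    "\<forall>m n x. m \<le> x \<longrightarrow> n \<le> x \<longrightarrow> g m n \<le> poly q x"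
    using assms unfolding poly_bounded_def by blast
  then show ?thesis
    unfolding poly_bounded_def by (intro exI[of _ "p + q"]) (auto intro: add_mono)
qed

lemma poly_bounded_mult:
  assumes "poly_bounded f" "poly_bounded g"
  shows "poly_bounded (\<lambda>m n. f m n * g m n)"
proof -
  obtain p q where "\<forall>m n x. m \<le> x \<longrightarrow> n \<le> x \<longrightarrow> f m n \<le> poly p x"
    "\<forall>m n x. m \<le> x \<longrightarrow> n \<le> x \<longrightarrow> g m n \<le> poly q x"
    using assms unfolding poly_bounded_def by blast
  then show ?thesis
    unfolding poly_bounded_def by (intro exI[of _ "p * q"]) (auto intro: mult_mono)
qed

text \<open>Unfolded, the running time is built from \<open>m\<close>, \<open>n\<close> and
  constants by sums and products alone.\<close>

lemma poly_bounded_main_time: "poly_bounded main_time"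
proof -
  have "poly_bounded (\<lambda>m n. main_time m n)"
    unfolding main_time_def search_time_def decide_time_def evaluate_time_def descend_time_def
      row_time_def for_time_def rounds_def scale_def power2_eq_square
    by (intro poly_bounded_add poly_bounded_mult poly_bounded_args poly_bounded_const)
  then show ?thesis by simp
qed

section \<open>From coefficient functions back to chains of the complex\<close>

text \<open>Every nonzero entry contributes exactly 1 to the norm; this links the counting objective
  to the convex one.\<close>

lemma num_nonzero_eq_sum:
  assumes "signed_unit_chain m z"
  shows "int (num_nonzero z) = (\<Sum>i<m. \<bar>z $ i\<bar>)"
proof -
  have dim: "dim_vec z = m" and unit: "\<forall>i<m. z $ i \<in> {-1, 0, 1}"
    using assms by (auto simp: signed_unit_chain_def)
  have "int (num_nonzero z) = (\<Sum>i\<in>{i. i < m \<and> z $ i \<noteq> 0}. 1)"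
    by (simp add: num_nonzero_def dim)
  also have "\<dots> = (\<Sum>i\<in>{i. i < m \<and> z $ i \<noteq> 0}. \<bar>z $ i\<bar>)"
    using unit by (intro sum.cong) auto
  also have "\<dots> = (\<Sum>i<m. \<bar>z $ i\<bar>)"
    by (rule sum.mono_neutral_left) auto
  finally show ?thesis .
qed

theorem main_prog_optimal:
  assumes tu: "totally_unimodular A" and c: "signed_unit_chain (dim_row A) c"
  shows "ends_in main_prog (input_state A c) (main_time (dim_row A) (dim_col A))
    (\<lambda>s. optimal_homologous_chain A c (output_chain (dim_row A) s))"
proof -
  define m n where "m = dim_row A" and "n = dim_col A"
  then have dims: "dim_row A = m" "dim_col A = n" by simp_all
  have dc: "c \<in> carrier_vec m" "dim_vec c = m" and cu: "\<And>i. i < m \<Longrightarrow> c $ i \<in> {-1, 0, 1}"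
    using c by (auto simp: signed_unit_chain_def m_def)
  interpret chain_problem m n "\<lambda>i j. A $$ (i, j)" "\<lambda>i. c $ i"
  proof
    show "tu_array m n (\<lambda>i j. A $$ (i, j))"
      unfolding m_def n_def by (rule totally_unimodular_tu_array[OF tu])
    show "\<bar>c $ i\<bar> \<le> 1" if "i < m" for i
      using cu[OF that] by auto
  qed
  have chain_vec: "(c + A *\<^sub>v y) $ i = chain (\<lambda>j. y $ j) i" if "y \<in> carrier_vec n" "i < m" for y i
    using that by (simp add: chain_def dims scalar_prod_def lessThan_atLeast0)
  \<comment> \<open>The row-major index must stay below \<open>m * n\<close> to hit the stored part
    of the array; quotient and remainder by \<open>n\<close> then recover row and column.\<close>
  have entries: "arrays (input_state A c) aD (int i * int n + int j) = A $$ (i, j)"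
    if "i < m" "j < n" for i j
  proof -
    have "i * n + j < m * n"
    proof -
      have "i * n + j < Suc i * n" using that by simp
      also have "\<dots> \<le> m * n" using that by (intro mult_le_mono) auto
      finally show ?thesis .
    qed
    then have "int i * int n + int j < int m * int n"
      by (metis of_nat_add of_nat_less_iff of_nat_mult)
    moreover have "nat (int i * int n + int j) = i * n + j"
      by (simp add: nat_add_distrib nat_mult_distrib)
    ultimately show ?thesis
      using that by (simp add: input_state_def dims)
  qed
  have "ends_in main_prog (input_state A c) (main_time m n) (\<lambda>s'. \<exists>y.
    (\<forall>i<m. arrays s' alo (int i) = chain y i \<and> \<bar>chain y i\<bar> \<le> 1) \<and>
    (\<forall>y'. (\<forall>i<m. \<bar>chain y' i\<bar> \<le> 1) \<longrightarrow> (\<Sum>i<m. \<bar>chain y i\<bar>) \<le> (\<Sum>i<m. \<bar>chain y' i\<bar>)))"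
    by (rule main_prog_spec) (use entries dc in \<open>auto simp: input_state_def dims\<close>)
  then have "ends_in main_prog (input_state A c) (main_time m n)
    (\<lambda>s. optimal_homologous_chain A c (output_chain m s))"
  proof (rule ends_in_mono)
    fix s assume "\<exists>y. (\<forall>i<m. arrays s alo (int i) = chain y i \<and> \<bar>chain y i\<bar> \<le> 1) \<and>
      (\<forall>y'. (\<forall>i<m. \<bar>chain y' i\<bar> \<le> 1) \<longrightarrow> (\<Sum>i<m. \<bar>chain y i\<bar>) \<le> (\<Sum>i<m. \<bar>chain y' i\<bar>))"
    then obtain y where y: "\<And>i. i < m \<Longrightarrow> arrays s alo (int i) = chain y i"
      "\<And>i. i < m \<Longrightarrow> \<bar>chain y i\<bar> \<le> 1"
      and opt: "\<And>y'. (\<forall>i<m. \<bar>chain y' i\<bar> \<le> 1) \<Longrightarrow> (\<Sum>i<m. \<bar>chain y i\<bar>) \<le> (\<Sum>i<m. \<bar>chain y' i\<bar>)"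
      by blast
    let ?z = "output_chain m s"
    have z: "?z $ i = chain y i" if "i < m" for i
      using y that by (simp add: output_chain_def)
    have unit: "signed_unit_chain m ?z"
      unfolding signed_unit_chain_def
    proof (intro conjI allI impI)
      fix i assume "i < m"
      then show "?z $ i \<in> {-1, 0, 1}"
        using y(2)[of i] by (auto simp: z)
    qed (simp add: output_chain_def)
    have "?z = c + A *\<^sub>v vec n y"
    proof (rule eq_vecI)
      fix i assume "i < dim_vec (c + A *\<^sub>v vec n y)"
      then have i: "i < m" by (simp add: dims)
      then show "?z $ i = (c + A *\<^sub>v vec n y) $ i"
        unfolding z[OF i] chain_vec[OF vec_carrier i] by (simp add: chain_def)
    qed (simp add: output_chain_def dims)
    then have "homologous A ?z c"
      unfolding homologous_def by (intro bexI[of _ "vec n y"]) (auto simp: dims)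
    moreover have "num_nonzero ?z \<le> num_nonzero z'"
      if z': "signed_unit_chain m z'" "homologous A z' c" for z'
    proof -
      obtain y' where y': "y' \<in> carrier_vec n" "z' = c + A *\<^sub>v y'"
        using z'(2) unfolding homologous_def dims by blast
      have z'_eq: "z' $ i = chain (\<lambda>j. y' $ j) i" if "i < m" for i
        unfolding y'(2) using y'(1) that by (rule chain_vec)
      have "z' $ i \<in> {-1, 0, 1}" if "i < m" for i
        using z'(1) that by (simp add: signed_unit_chain_def)
      then have "\<forall>i<m. \<bar>chain (\<lambda>j. y' $ j) i\<bar> \<le> 1"
        using z'_eq by force
      from opt[OF this] have "(\<Sum>i<m. \<bar>?z $ i\<bar>) \<le> (\<Sum>i<m. \<bar>z' $ i\<bar>)"
        by (simp add: z z'_eq)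
      then show ?thesis
        using num_nonzero_eq_sum[OF unit] num_nonzero_eq_sum[OF z'(1)] by linarith
    qed
    ultimately show "optimal_homologous_chain A c ?z"
      using unit unfolding optimal_homologous_chain_def dims by blast
  qed simp
  then show ?thesis by (simp add: dims)
qed

text \<open>Distinct basis elements have distinct vertex sets, so the dimensions of the boundary
  matrix, and with them the running time, are controlled by the number of simplices.\<close>

lemma length_oriented_basis_le:
  assumes "finite K" "oriented_basis K p P"
  shows "length P \<le> card K"
proof -
  have "length P = card (set (map set P))"
    using assms distinct_card[of "map set P"] by (simp add: oriented_basis_def)
  also have "\<dots> = card (simplices K p)"
    using assms by (simp add: oriented_basis_def)
  also have "\<dots> \<le> card K"
    using assms by (intro card_mono) (auto simp: simplices_def)
  finally show ?thesis .
qed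

theorem theorem3p13:
  shows "\<exists>(A :: prog) (q :: nat poly).
    \<forall>(K :: 'v set set) (p :: nat) (P :: 'v list list) (Q :: 'v list list) (c :: int vec).
      finite_simplicial_complex K \<and> complex_dim K > int p \<and>
      oriented_basis K p P \<and> oriented_basis K (p + 1) Q \<and>
      totally_unimodular (boundary_matrix P Q) \<and>
      signed_unit_chain (length P) c
      \<longrightarrow> (\<exists>t s. runs A (input_state (boundary_matrix P Q) c) t s \<and>
                t \<le> poly q (card K) \<and>
                optimal_homologous_chain (boundary_matrix P Q) c (output_chain (length P) s))"
proof -
  obtain q where q: "\<And>m n x. m \<le> x \<Longrightarrow> n \<le> x \<Longrightarrow> main_time m n \<le> poly q x"
    using poly_bounded_main_time unfolding poly_bounded_def by blast
  show ?thesis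
  proof (intro exI[of _ main_prog] exI[of _ q] allI impI; elim conjE)
    fix K :: "'v set set" and p P Q c
    assume K: "finite_simplicial_complex K" and PQ: "oriented_basis K p P" "oriented_basis K (p + 1) Q"
      and tu: "totally_unimodular (boundary_matrix P Q)" and c: "signed_unit_chain (length P) c"
    have dims: "dim_row (boundary_matrix P Q) = length P" "dim_col (boundary_matrix P Q) = length Q"
      by (simp_all add: boundary_matrix_def)
    have "length P \<le> card K" "length Q \<le> card K"
      using K PQ by (auto simp: finite_simplicial_complex_def intro: length_oriented_basis_le)
    then have "main_time (length P) (length Q) \<le> poly q (card K)"
      by (rule q)
    then show "\<exists>t s. runs main_prog (input_state (boundary_matrix P Q) c) t s \<and>
        t \<le> poly q (card K) \<and>
        optimal_homologous_chain (boundary_matrix P Q) c (output_chain (length P) s)"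
      using main_prog_optimal[OF tu, unfolded dims, OF c] order_trans
      unfolding ends_in_def by blast
  qed
qed

end
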